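(* Let $\{\xi_{\mathbf i}:\mathbf i\in\mathbb Z^q\}$ be a strictly stationary, $\varphi$-mixing random field with values in $\mathbb R^p$, with $\mathbb E(\xi_{\mathbf 0})=\mathbf 0$, $\max_{1\le j\le p}\mathbb E\big(\xi_{\mathbf 0}^{(j)}\big)^4<\infty$, and mixing coefficients satisfying $\sum_{r=1}^\infty r^{q-1}\varphi^{1/2}(r)<\infty$. Let the weights $w_{\mathbf m}(\mathbf j)$ satisfy (W1) $w_{\mathbf m}(\mathbf j)\to1$ as $\mathbf m\to\infty$ for all $\mathbf j\in\mathbb Z^q$, and (W2) $|w_{\mathbf m}(\mathbf j)|\le C_w<\infty$ for a constant $C_w$ independent of $\mathbf j$ and $\mathbf m$. Let $\mathbf m=\mathbf m_{\mathbf n}\in\mathbb N^q$ satisfy $\mathbf m\to\infty$ as $\mathbf n\to\infty$ and $(m^\star)^3/n_\star=o(1)$, where $m^\star=\max_{1\le i\le q}m_i$ and $n_\star=\min_{1\le i\le q}n_i$. Then the estimator $\widehat\sigma_{\mathbf n}^2=\sum_{|\mathbf j|\le\mathbf m}w_{\mathbf m}(\mathbf j)\widehat\gamma_{\mathbf n}(\mathbf j)$ is weakly consistent for $\sigma^2$, i.e. $\|\widehat\sigma_{\mathbf n}^2-\sigma^2\|_\infty\to0$ in probability as $\mathbf n\to\infty$.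
   Context: Fix integers $p,q\ge1$. For $\mathbf n=(n_1,\dots,n_q)\in\mathbb N^q$, $\mathbf n\to\infty$ means $\min_i n_i\to\infty$ (likewise for $\mathbf m$). $|\mathbf n|=\prod_i n_i$, $\Gamma_{\mathbf n}=\{1,\dots,n_1\}\times\dots\times\{1,\dots,n_q\}$. For $\mathbf j\in\mathbb Z^q$, $|\mathbf j|\le\mathbf m$ means $|j_i|\le m_i$ for all $i$. Random fields take values in $\mathbb R^p$ (column vectors $\xi_{\mathbf i}=(\xi_{\mathbf i}^{(1)},\dots,\xi_{\mathbf i}^{(p)})'$, where $'$ is transposition). For a matrix $A=(a_{ij})$, $\|A\|_\infty=\max_{i,j}|a_{ij}|$. Mixing: for $1\le j\le q$ and $r\ge0$ let $\mathcal A^+(j;r)=\sigma(\xi_{\mathbf n}:n_j\ge r,\ n_i \text{ unrestricted for } i\ne j)$ and $\mathcal A^-(j;r)=\sigma(\xi_{\mathbf n}:n_j\le r,\ n_i\text{ unrestricted for } i\neq j)$. For $r\ge1$ let $\varphi(j;r)=\sup\{|\mathbb P(B|A)-\mathbb P(B)|:A\in\mathcal A^-(j;0),B\in\mathcal A^+(j;r),\mathbb P(A)>0\}$, $\varphi(r)=\max_{1\le j\le q}\varphi(j;r)$, and $\varphi(0)=1$. The field is $\varphi$-mixing if $\varphi(r)\to0$ as $r\to\infty$. Autocovariances: $\gamma(\mathbf j)=\mathbb E(\xi_{\mathbf 0}\xi_{\mathbf j}')$ and $\widehat\gamma_{\mathbf n}(\mathbf j)=|\widetilde\Gamma_{\mathbf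 n}(\mathbf j)|^{-1}\sum_{\mathbf i\in\widetilde\Gamma_{\mathbf n}(\mathbf j)}\xi_{\mathbf i}\xi_{\mathbf i+\mathbf j}'$, where $\widetilde\Gamma_{\mathbf n}(\mathbf j)=\{\mathbf i\in\Gamma_{\mathbf n}:\mathbf i+\mathbf j\in\Gamma_{\mathbf n}\}$. The asymptotic variance is the $p\times p$ matrix $\sigma^2=\sum_{\mathbf k\in\mathbb Z^q}\mathbb E(\xi_{\mathbf 0}\xi_{\mathbf k}')=\lim_{\mathbf n\to\infty}|\mathbf n|^{-1}\mathbb E(S_{\mathbf n}S_{\mathbf n}')$ with $S_{\mathbf n}=\sum_{\mathbf i\in\Gamma_{\mathbf n}}\xi_{\mathbf i}$. The weights $w_{\mathbf m}(\mathbf j)$ ($\mathbf m\in\mathbb N^q$, $\mathbf j\in\mathbb Z^q$) are real numbers. *)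

theory Defs
  imports "HOL-Probability.Probability"
begin

text \<open>
  A random field with values in \<open>\<real>\<^sup>p\<close> over \<open>\<int>\<^sup>q\<close> is a family \<open>\<xi> :: int^'q \<Rightarrow> 'a \<Rightarrow> real^'p\<close>;
  the dimensions are \<open>q = CARD('q)\<close> and \<open>p = CARD('p)\<close>, both automatically positive.
\<close>

subsection \<open>Multi-indices\<close>

definition min_comp :: "nat^'q \<Rightarrow> nat" where
  "min_comp n = Min (range (\<lambda>i. n $ i))"

definition max_comp :: "nat^'q \<Rightarrow> nat" where
  "max_comp n = Max (range (\<lambda>i. n $ i))"

text \<open>The filter of \<open>n \<rightarrow> \<infinity>\<close> in the sense that all components tend to infinity
  simultaneously.  Indices with a zero component are eventually excluded.\<close>

definition multi_at_top :: "(nat^'q) filter" where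
  "multi_at_top = filtercomap min_comp at_top"

definition Gamma_set :: "nat^'q \<Rightarrow> (int^'q) set" where
  "Gamma_set n = {i. \<forall>k. 1 \<le> i $ k \<and> i $ k \<le> int (n $ k)}"

definition Gamma_shift :: "nat^'q \<Rightarrow> int^'q \<Rightarrow> (int^'q) set" where
  "Gamma_shift n j = {i \<in> Gamma_set n. i + j \<in> Gamma_set n}"

definition lag_window :: "nat^'q \<Rightarrow> (int^'q) set" where
  "lag_window m = {j. \<forall>k. \<bar>j $ k\<bar> \<le> int (m $ k)}"

subsection \<open>Matrices\<close>

text \<open>The matrix \<open>x y'\<close> for column vectors \<open>x\<close> and \<open>y\<close>.\<close>

definition outer_prod :: "real^'p \<Rightarrow> real^'p \<Rightarrow> real^'p^'p" where
  "outer_prod x y = (\<chi> a b. x $ a * y $ b)"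

definition mat_supnorm :: "real^'p^'p \<Rightarrow> real" where
  "mat_supnorm A = Max (range (\<lambda>(a, b). \<bar>A $ a $ b\<bar>))"

subsection \<open>Stationarity and mixing\<close>

definition random_field :: "'a measure \<Rightarrow> (int^'q \<Rightarrow> 'a \<Rightarrow> real^'p) \<Rightarrow> bool" where
  "random_field M \<xi> \<longleftrightarrow> (\<forall>i. \<xi> i \<in> borel_measurable M)"

text \<open>All finite-dimensional distributions are invariant under translations of the index set.\<close>

definition strictly_stationary :: "'a measure \<Rightarrow> (int^'q \<Rightarrow> 'a \<Rightarrow> real^'p) \<Rightarrow> bool" where
  "strictly_stationary M \<xi> \<longleftrightarrow>
    (\<forall>J k. finite J \<longrightarrow>
       distr M (\<Pi>\<^sub>M i\<in>J. borel) (\<lambda>\<omega>. \<lambda>i\<in>J. \<xi> (i + k) \<omega>) =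
       distr M (\<Pi>\<^sub>M i\<in>J. borel) (\<lambda>\<omega>. \<lambda>i\<in>J. \<xi> i \<omega>))"

definition generated_events ::
    "'a measure \<Rightarrow> (int^'q \<Rightarrow> 'a \<Rightarrow> real^'p) \<Rightarrow> (int^'q) set \<Rightarrow> 'a set set" where
  "generated_events M \<xi> I =
    sigma_sets (space M) {\<xi> i -` B \<inter> space M | i B. i \<in> I \<and> B \<in> sets borel}"

definition A_plus :: "'a measure \<Rightarrow> (int^'q \<Rightarrow> 'a \<Rightarrow> real^'p) \<Rightarrow> 'q \<Rightarrow> nat \<Rightarrow> 'a set set" where
  "A_plus M \<xi> j r = generated_events M \<xi> {n. n $ j \<ge> int r}"

definition A_minus :: "'a measure \<Rightarrow> (int^'q \<Rightarrow> 'a \<Rightarrow> real^'p) \<Rightarrow> 'q \<Rightarrow> nat \<Rightarrow> 'a set set" where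
  "A_minus M \<xi> j r = generated_events M \<xi> {n. n $ j \<le> int r}"

definition phi_dir :: "'a measure \<Rightarrow> (int^'q \<Rightarrow> 'a \<Rightarrow> real^'p) \<Rightarrow> 'q \<Rightarrow> nat \<Rightarrow> real" where
  "phi_dir M \<xi> j r =
    Sup {\<bar>cond_prob M (\<lambda>\<omega>. \<omega> \<in> B) (\<lambda>\<omega>. \<omega> \<in> A) - measure M B\<bar> | A B.
           A \<in> A_minus M \<xi> j 0 \<and> B \<in> A_plus M \<xi> j r \<and> measure M A > 0}"

definition phi_coeff :: "'a measure \<Rightarrow> (int^'q \<Rightarrow> 'a \<Rightarrow> real^'p) \<Rightarrow> nat \<Rightarrow> real" where
  "phi_coeff M \<xi> r = (if r = 0 then 1 else Max (range (\<lambda>j. phi_dir M \<xi> j r)))"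

definition phi_mixing :: "'a measure \<Rightarrow> (int^'q \<Rightarrow> 'a \<Rightarrow> real^'p) \<Rightarrow> bool" where
  "phi_mixing M \<xi> \<longleftrightarrow> phi_coeff M \<xi> \<longlonglongrightarrow> 0"

subsection \<open>Autocovariances and the long-run variance estimator\<close>

definition autocov :: "'a measure \<Rightarrow> (int^'q \<Rightarrow> 'a \<Rightarrow> real^'p) \<Rightarrow> int^'q \<Rightarrow> real^'p^'p" where
  "autocov M \<xi> j = (\<integral>\<omega>. outer_prod (\<xi> 0 \<omega>) (\<xi> j \<omega>) \<partial>M)"

definition sample_autocov ::
    "(int^'q \<Rightarrow> 'a \<Rightarrow> real^'p) \<Rightarrow> nat^'q \<Rightarrow> int^'q \<Rightarrow> 'a \<Rightarrow> real^'p^'p" where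
  "sample_autocov \<xi> n j \<omega> =
    (1 / real (card (Gamma_shift n j))) *\<^sub>R
      (\<Sum>i\<in>Gamma_shift n j. outer_prod (\<xi> i \<omega>) (\<xi> (i + j) \<omega>))"

text \<open>The series over \<open>\<int>\<^sup>q\<close> is an unordered sum; it converges absolutely under
  the usual summability conditions on the mixing coefficients.\<close>

definition asymp_variance :: "'a measure \<Rightarrow> (int^'q \<Rightarrow> 'a \<Rightarrow> real^'p) \<Rightarrow> real^'p^'p" where
  "asymp_variance M \<xi> = (\<Sum>\<^sub>\<infinity>k. autocov M \<xi> k)"

definition variance_estimator ::
    "(nat^'q \<Rightarrow> int^'q \<Rightarrow> real) \<Rightarrow> (int^'q \<Rightarrow> 'a \<Rightarrow> real^'p) \<Rightarrow>
      nat^'q \<Rightarrow> nat^'q \<Rightarrow> 'a \<Rightarrow> real^'p^'p" where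
  "variance_estimator w \<xi> m n \<omega> = (\<Sum>j\<in>lag_window m. w m j *\<^sub>R sample_autocov \<xi> n j \<omega>)"

definition tendsto_in_prob ::
    "'a measure \<Rightarrow> ('i \<Rightarrow> 'a \<Rightarrow> real) \<Rightarrow> real \<Rightarrow> 'i filter \<Rightarrow> bool" where
  "tendsto_in_prob M X c F \<longleftrightarrow>
    (\<forall>\<epsilon>>0. ((\<lambda>n. measure M {\<omega> \<in> space M. \<bar>X n \<omega> - c\<bar> > \<epsilon>}) \<longlongrightarrow> 0) F)"

end

theory Submission
  imports Defs
begin

text \<open>
  The error of the estimator splits into a random and a deterministic part,
  \<open>\<Sum>\<^bsub>\<bar>j\<bar> \<le> m\<^esub> w\<^sub>m(j) (\<gamma>\<^sub>n(j) - \<gamma>(j))\<close> and \<open>\<Sum>\<^bsub>\<bar>j\<bar> \<le> m\<^esub> w\<^sub>m(j) \<gamma>(j) - \<Sum>\<^sub>j \<gamma>(j)\<close>, where \<open>\<gamma>\<^sub>n(j)\<close> is the sample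
  autocovariance. Both are controlled by Ibragimov's inequality
  \<open>\<bar>Cov(X, Y)\<bar> \<le> 2 \<phi>(r)\<^sup>1\<^sup>/\<^sup>2 (E X\<^sup>2)\<^sup>1\<^sup>/\<^sup>2 (E Y\<^sup>2)\<^sup>1\<^sup>/\<^sup>2\<close>, valid when \<open>X\<close> and \<open>Y\<close> depend on parts of the field
  separated by \<open>r\<close> in one coordinate (\<open>covariance_le_phi_mixing\<close>, \<open>covariance_le\<close>).

  Bias. The inequality gives \<open>\<gamma>(j) = O(\<phi>(\<bar>j\<bar>)\<^sup>1\<^sup>/\<^sup>2)\<close> with \<open>\<bar>j\<bar> = max\<^sub>k \<bar>j\<^sub>k\<bar>\<close>. There are \<open>O(r\<^sup>q\<^sup>-\<^sup>1)\<close>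
  lags with \<open>\<bar>j\<bar> = r\<close>, so the rate condition implies that \<open>\<gamma>\<close> is absolutely summable
  (\<open>abs_summable_autocov\<close>), and the bias vanishes by dominated convergence
  (\<open>tendsto_weighted_sum_lag_window\<close>).

  Random part. Write \<open>N\<close> for the largest component of \<open>m\<close> and \<open>L\<close> for the smallest component of \<open>n\<close>.
  For \<open>\<bar>j\<bar> \<le> N\<close> the products \<open>\<xi>\<^sub>i \<xi>\<^sub>i\<^sub>+\<^sub>j'\<close> and \<open>\<xi>\<^sub>k \<xi>\<^sub>k\<^sub>+\<^sub>j'\<close> depend on sites separated by at least
  \<open>\<bar>k - i\<bar> - N\<close>, and their entries are square integrable because the field has fourth moments. Summing
  the covariance bounds over \<open>k\<close> gives \<open>O(N\<^sup>q)\<close>: the \<open>O(N\<^sup>q)\<close> sites close to \<open>i\<close> contribute \<open>O(1)\<close> each, and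
  the distant ones are again summed by the rate condition. As at least \<open>(L - N)\<^sup>q\<close> products enter
  \<open>\<gamma>\<^sub>n(j)\<close>, each \<open>\<gamma>\<^sub>n(j) - \<gamma>(j)\<close> is \<open>O((N / (L - N))\<^sup>q\<^sup>/\<^sup>2)\<close> in mean, uniformly in \<open>j\<close>
  (\<open>expectation_sample_autocov_error_le\<close>). The window has \<open>O(N\<^sup>q)\<close> lags, and summing the errors over them
  gives \<open>O((N\<^sup>3 / (L - N))\<^sup>q\<^sup>/\<^sup>2)\<close>, which is where the condition \<open>N\<^sup>3 / L \<rightarrow> 0\<close> comes from. Markov's
  inequality turns convergence in mean into convergence in probability.
\<close>

section \<open>The covariance inequality under a mixing bound\<close>

text \<open>
  The defects are added first over the \<open>y\<close> for which they are nonnegative and then over the others.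
  Each partial sum is the defect of a single event \<open>Y \<in> S\<close>, to which the mixing bound applies.
\<close>

lemma (in prob_space) sum_abs_mixing_defect_le:
  fixes Y :: "'a \<Rightarrow> 'b"
  assumes A: "A \<in> events"
    and Y: "\<And>S. S \<subseteq> R \<Longrightarrow> Y -` S \<inter> space M \<in> G" and "G \<subseteq> events" and "finite R"
    and mix: "\<And>B. B \<in> G \<Longrightarrow> \<bar>prob (A \<inter> B) - prob A * prob B\<bar> \<le> c"
  shows "(\<Sum>y\<in>R. \<bar>prob (A \<inter> (Y -` {y} \<inter> space M)) - prob A * prob (Y -` {y} \<inter> space M)\<bar>) \<le> 2 * c"
proof -
  define E where "E S = Y -` S \<inter> space M" for S
  define d where "d y = prob (A \<inter> E {y}) - prob A * prob (E {y})" for y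
  have ev: "E S \<in> events" if "S \<subseteq> R" for S
    using Y[OF that] \<open>G \<subseteq> events\<close> by (auto simp: E_def)
  have sum_d: "\<bar>sum d S\<bar> \<le> c" if "S \<subseteq> R" for S
  proof -
    have "finite S" using that \<open>finite R\<close> finite_subset by blast
    have "E S = (\<Union>y\<in>S. E {y})" by (auto simp: E_def)
    moreover have "disjoint_family_on (\<lambda>y. E {y}) S" by (auto simp: disjoint_family_on_def E_def)
    ultimately have 1: "prob (E S) = (\<Sum>y\<in>S. prob (E {y}))"
      using \<open>finite S\<close> ev that by (subst finite_measure_finite_Union[symmetric]) auto
    have "A \<inter> E S = (\<Union>y\<in>S. A \<inter> E {y})" by (auto simp: E_def)
    moreover have "disjoint_family_on (\<lambda>y. A \<inter> E {y}) S" by (auto simp: disjoint_family_on_def E_def)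
    moreover have "A \<inter> E {y} \<in> events" if "y \<in> S" for y
      using A ev[of "{y}"] \<open>S \<subseteq> R\<close> that by auto
    ultimately have 2: "prob (A \<inter> E S) = (\<Sum>y\<in>S. prob (A \<inter> E {y}))"
      using \<open>finite S\<close> by (subst finite_measure_finite_Union[symmetric]) auto
    have "sum d S = prob (A \<inter> E S) - prob A * prob (E S)"
      by (simp add: d_def sum_subtractf sum_distrib_left 1 2)
    then show ?thesis using mix[OF Y[OF that]] by (simp add: E_def)
  qed
  have "(\<Sum>y\<in>R. \<bar>d y\<bar>) = (\<Sum>y\<in>{y\<in>R. d y \<ge> 0}. \<bar>d y\<bar>) + (\<Sum>y\<in>{y\<in>R. \<not> d y \<ge> 0}. \<bar>d y\<bar>)"
    using \<open>finite R\<close> by (subst sum.union_disjoint[symmetric]) (auto intro!: sum.cong)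
  also have "(\<Sum>y\<in>{y\<in>R. d y \<ge> 0}. \<bar>d y\<bar>) = sum d {y\<in>R. d y \<ge> 0}"
    by (intro sum.cong) auto
  also have "(\<Sum>y\<in>{y\<in>R. \<not> d y \<ge> 0}. \<bar>d y\<bar>) = - sum d {y\<in>R. \<not> d y \<ge> 0}"
    unfolding sum_negf[symmetric] by (intro sum.cong) auto
  finally show ?thesis
    using sum_d[of "{y\<in>R. d y \<ge> 0}"] sum_d[of "{y\<in>R. \<not> d y \<ge> 0}"]
    by (simp add: d_def E_def)
qed

lemma (in prob_space) expectation_finite_range:
  fixes Z :: "'a \<Rightarrow> 'b" and h :: "'b \<Rightarrow> real"
  assumes "finite R" and "Z \<in> space M \<rightarrow> R" and "\<And>z. z \<in> R \<Longrightarrow> Z -` {z} \<inter> space M \<in> events"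
  shows "expectation (\<lambda>\<omega>. h (Z \<omega>)) = (\<Sum>z\<in>R. h z * prob (Z -` {z} \<inter> space M))"
proof -
  have "expectation (\<lambda>\<omega>. h (Z \<omega>)) =
      expectation (\<lambda>\<omega>. \<Sum>z\<in>R. h z * indicator (Z -` {z} \<inter> space M) \<omega>)"
  proof (rule Bochner_Integration.integral_cong[OF refl])
    fix \<omega> assume \<omega>: "\<omega> \<in> space M"
    have "(\<Sum>z\<in>R. h z * indicator (Z -` {z} \<inter> space M) \<omega>) = (\<Sum>z\<in>R. if z = Z \<omega> then h z else 0)"
      using \<omega> by (intro sum.cong) (auto simp: indicator_def)
    then show "h (Z \<omega>) = (\<Sum>z\<in>R. h z * indicator (Z -` {z} \<inter> space M) \<omega>)"
      using assms(1,2) \<omega> by auto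
  qed
  also have "\<dots> = (\<Sum>z\<in>R. h z * prob (Z -` {z} \<inter> space M))"
    using assms(3) by (subst Bochner_Integration.integral_sum)
      (auto intro!: integrable_mult_right integrable_real_indicator simp: less_top[symmetric])
  finally show ?thesis .
qed

text \<open>
  With \<open>d(x, y) = P(X = x, Y = y) - P(X = x) P(Y = y)\<close>, the covariance is \<open>\<Sum> x y d(x, y)\<close>, and
  the Cauchy--Schwarz inequality with weights \<open>\<bar>d\<bar>\<close> bounds its square by
  \<open>(\<Sum> x\<^sup>2 \<bar>d(x, y)\<bar>) (\<Sum> y\<^sup>2 \<bar>d(x, y)\<bar>)\<close>. Mixing is used in the first factor only, where the sums over \<open>y\<close>
  are at most \<open>2 c P(X = x)\<close>; in the second factor the sums over \<open>x\<close> are trivially at most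
  \<open>2 P(Y = y)\<close>. This is why the square root of the mixing bound appears.
\<close>

lemma (in prob_space) covariance_le_simple:
  fixes X Y :: "'a \<Rightarrow> real"
  assumes F: "subalgebra M F" and G: "subalgebra M G"
    and mix: "\<And>A B. A \<in> sets F \<Longrightarrow> B \<in> sets G \<Longrightarrow> \<bar>prob (A \<inter> B) - prob A * prob B\<bar> \<le> c * prob A"
    and X: "simple_function F X" and Y: "simple_function G Y"
  shows "(expectation (\<lambda>\<omega>. X \<omega> * Y \<omega>) - expectation X * expectation Y)\<^sup>2
    \<le> 4 * c * expectation (\<lambda>\<omega>. (X \<omega>)\<^sup>2) * expectation (\<lambda>\<omega>. (Y \<omega>)\<^sup>2)"
proof -
  have sp: "space F = space M" "space G = space M" and sub: "sets F \<subseteq> events" "sets G \<subseteq> events"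
    using F G by (auto simp: subalgebra_def)
  define P where "P = X ` space M"
  define Q where "Q = Y ` space M"
  have fin: "finite P" "finite Q"
    using X Y by (auto simp: simple_function_def sp P_def Q_def)
  define level_X where "level_X x = X -` {x} \<inter> space M" for x
  define level_Y where "level_Y y = Y -` {y} \<inter> space M" for y
  have level_X: "level_X x \<in> sets F" for x
    using simple_functionD(2)[OF X, of "{x}"] by (simp add: level_X_def sp)
  have YS: "Y -` S \<inter> space M \<in> sets G" for S
    using simple_functionD(2)[OF Y, of S] by (simp add: sp)
  have level_Y: "level_Y y \<in> sets G" for y
    using YS by (simp add: level_Y_def)
  have XS: "X -` S \<inter> space M \<in> sets F" for S
    using simple_functionD(2)[OF X, of S] by (simp add: sp)
  have ev: "level_X x \<in> events" "level_Y y \<in> events" for x y using level_X level_Y sub by auto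
  define d where "d x y = prob (level_X x \<inter> level_Y y) - prob (level_X x) * prob (level_Y y)" for x y
  have hX: "expectation (\<lambda>\<omega>. h (X \<omega>)) = (\<Sum>x\<in>P. h x * prob (level_X x))" for h :: "real \<Rightarrow> real"
    using ev(1) unfolding level_X_def by (intro expectation_finite_range fin) (auto simp: P_def)
  have hY: "expectation (\<lambda>\<omega>. h (Y \<omega>)) = (\<Sum>y\<in>Q. h y * prob (level_Y y))" for h :: "real \<Rightarrow> real"
    using ev(2) unfolding level_Y_def by (intro expectation_finite_range fin) (auto simp: Q_def)
  have vim: "(\<lambda>\<omega>. (X \<omega>, Y \<omega>)) -` {z} \<inter> space M = level_X (fst z) \<inter> level_Y (snd z)" for z
    by (auto simp: level_X_def level_Y_def)
  have hXY: "expectation (\<lambda>\<omega>. X \<omega> * Y \<omega>) = (\<Sum>z\<in>P \<times> Q. fst z * snd z * prob (level_X (fst z) \<inter> level_Y (snd z)))"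
    using expectation_finite_range[of "P \<times> Q" "\<lambda>\<omega>. (X \<omega>, Y \<omega>)" "\<lambda>z. fst z * snd z"] fin ev
    unfolding vim by (auto simp: P_def Q_def)
  have "expectation X * expectation Y = (\<Sum>z\<in>P \<times> Q. fst z * snd z * (prob (level_X (fst z)) * prob (level_Y (snd z))))"
    using hX[of "\<lambda>x. x"] hY[of "\<lambda>x. x"]
    by (simp add: sum_product sum.cartesian_product split_def mult_ac)
  with hXY have D: "expectation (\<lambda>\<omega>. X \<omega> * Y \<omega>) - expectation X * expectation Y =
      (\<Sum>z\<in>P \<times> Q. fst z * snd z * d (fst z) (snd z))"
    by (simp add: d_def right_diff_distrib sum_subtractf)
  have row: "(\<Sum>y\<in>Q. \<bar>d x y\<bar>) \<le> 2 * (c * prob (level_X x))" for x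
    unfolding d_def level_Y_def
    by (rule sum_abs_mixing_defect_le[where G = "sets G"]) (use ev YS sub fin mix level_X in auto)
  have col: "(\<Sum>x\<in>P. \<bar>d x y\<bar>) \<le> 2 * prob (level_Y y)" for y
  proof -
    have "(\<Sum>x\<in>P. \<bar>prob (level_Y y \<inter> level_X x) - prob (level_Y y) * prob (level_X x)\<bar>) \<le> 2 * prob (level_Y y)"
      unfolding level_X_def
    proof (rule sum_abs_mixing_defect_le[where G = "sets F"])
      fix A assume "A \<in> sets F"
      then have "A \<in> events" using sub by auto
      have 1: "prob (level_Y y \<inter> A) \<le> prob (level_Y y)"
        using ev by (intro finite_measure_mono) auto
      have "prob (level_Y y) * prob A \<le> prob (level_Y y) * 1"
        by (intro mult_left_mono) auto
      then show "\<bar>prob (level_Y y \<inter> A) - prob (level_Y y) * prob A\<bar> \<le> prob (level_Y y)"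
        using 1 by (smt (verit) measure_nonneg mult_nonneg_nonneg)
    qed (use ev XS sub fin in auto)
    then show ?thesis by (simp add: d_def Int_commute mult.commute)
  qed
  have "\<bar>\<Sum>z\<in>P \<times> Q. fst z * snd z * d (fst z) (snd z)\<bar> \<le>
      (\<Sum>z\<in>P \<times> Q. (\<bar>fst z\<bar> * sqrt \<bar>d (fst z) (snd z)\<bar>) * (\<bar>snd z\<bar> * sqrt \<bar>d (fst z) (snd z)\<bar>))"
    by (intro order_trans[OF sum_abs] sum_mono) (simp add: abs_mult algebra_simps)
  then have "(\<Sum>z\<in>P \<times> Q. fst z * snd z * d (fst z) (snd z))\<^sup>2 \<le>
      (\<Sum>z\<in>P \<times> Q. (\<bar>fst z\<bar> * sqrt \<bar>d (fst z) (snd z)\<bar>) * (\<bar>snd z\<bar> * sqrt \<bar>d (fst z) (snd z)\<bar>))\<^sup>2"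
    by (simp add: abs_le_square_iff[symmetric])
  also have "\<dots> \<le> (\<Sum>z\<in>P \<times> Q. (\<bar>fst z\<bar> * sqrt \<bar>d (fst z) (snd z)\<bar>)\<^sup>2) *
      (\<Sum>z\<in>P \<times> Q. (\<bar>snd z\<bar> * sqrt \<bar>d (fst z) (snd z)\<bar>)\<^sup>2)"
    by (rule Cauchy_Schwarz_ineq_sum)
  also have "\<dots> = (\<Sum>x\<in>P. x\<^sup>2 * (\<Sum>y\<in>Q. \<bar>d x y\<bar>)) * (\<Sum>y\<in>Q. y\<^sup>2 * (\<Sum>x\<in>P. \<bar>d x y\<bar>))"
  proof -
    have "(\<Sum>y\<in>Q. y\<^sup>2 * (\<Sum>x\<in>P. \<bar>d x y\<bar>)) = (\<Sum>x\<in>P. \<Sum>y\<in>Q. y\<^sup>2 * \<bar>d x y\<bar>)"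
      unfolding sum_distrib_left by (rule sum.swap)
    then show ?thesis
      by (simp add: sum.cartesian_product split_def power_mult_distrib sum_distrib_left)
  qed
  also have "\<dots> \<le> (\<Sum>x\<in>P. x\<^sup>2 * (2 * (c * prob (level_X x)))) * (\<Sum>y\<in>Q. y\<^sup>2 * (2 * prob (level_Y y)))"
    by (intro mult_mono sum_mono mult_left_mono row col sum_nonneg mult_nonneg_nonneg
        order_trans[OF _ row]) auto
  also have "\<dots> = 4 * c * expectation (\<lambda>\<omega>. (X \<omega>)\<^sup>2) * expectation (\<lambda>\<omega>. (Y \<omega>)\<^sup>2)"
    using hX[of "\<lambda>x. x\<^sup>2"] hY[of "\<lambda>x. x\<^sup>2"] by (simp add: sum_distrib_left mult_ac)
  finally show ?thesis unfolding D .
qed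

lemma integrable_mult_of_squares:
  fixes X Y :: "'a \<Rightarrow> real"
  assumes "X \<in> borel_measurable M" "Y \<in> borel_measurable M"
    and "integrable M (\<lambda>\<omega>. (X \<omega>)\<^sup>2)" "integrable M (\<lambda>\<omega>. (Y \<omega>)\<^sup>2)"
  shows "integrable M (\<lambda>\<omega>. X \<omega> * Y \<omega>)"
proof (rule Bochner_Integration.integrable_bound)
  show "integrable M (\<lambda>\<omega>. (X \<omega>)\<^sup>2 + (Y \<omega>)\<^sup>2)" using assms by auto
  have "\<bar>x * y\<bar> \<le> x\<^sup>2 + y\<^sup>2" for x y :: real
  proof -
    have "0 \<le> \<bar>x\<bar> * \<bar>y\<bar>" by simp
    then show ?thesis
      using sum_squares_bound[of "\<bar>x\<bar>" "\<bar>y\<bar>"] unfolding abs_mult power2_abs by linarith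
  qed
  then show "AE x in M. norm (X x * Y x) \<le> norm ((X x)\<^sup>2 + (Y x)\<^sup>2)"
    by simp
qed (use assms in measurable)

text \<open>
  Ibragimov's inequality. Simple functions approximate \<open>X\<close> and \<open>Y\<close> pointwise within \<open>2 \<bar>X\<bar>\<close> and
  \<open>2 \<bar>Y\<bar>\<close>, so all moments in the inequality for simple functions converge by dominated convergence.
\<close>

theorem (in prob_space) covariance_le_phi_mixing:
  fixes X Y :: "'a \<Rightarrow> real"
  assumes F: "subalgebra M F" and G: "subalgebra M G"
    and mix: "\<And>A B. A \<in> sets F \<Longrightarrow> B \<in> sets G \<Longrightarrow> \<bar>prob (A \<inter> B) - prob A * prob B\<bar> \<le> c * prob A"
    and X: "X \<in> borel_measurable F" "integrable M (\<lambda>\<omega>. (X \<omega>)\<^sup>2)"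
    and Y: "Y \<in> borel_measurable G" "integrable M (\<lambda>\<omega>. (Y \<omega>)\<^sup>2)"
  shows "\<bar>expectation (\<lambda>\<omega>. X \<omega> * Y \<omega>) - expectation X * expectation Y\<bar>
    \<le> 2 * sqrt c * sqrt (expectation (\<lambda>\<omega>. (X \<omega>)\<^sup>2)) * sqrt (expectation (\<lambda>\<omega>. (Y \<omega>)\<^sup>2))"
proof -
  have sp: "space F = space M" "space G = space M"
    using F G by (auto simp: subalgebra_def)
  have [measurable]: "X \<in> borel_measurable M" "Y \<in> borel_measurable M"
    using X Y F G by (auto intro: measurable_from_subalg)
  have intX: "integrable M X" and intY: "integrable M Y"
    using square_integrable_imp_integrable[of X] square_integrable_imp_integrable[of Y] X(2) Y(2) by auto
  obtain s where s: "\<And>i. simple_function F (s i)" "\<And>\<omega>. \<omega> \<in> space M \<Longrightarrow> (\<lambda>i. s i \<omega>) \<longlonglongrightarrow> X \<omega>"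
      "\<And>i \<omega>. \<omega> \<in> space M \<Longrightarrow> \<bar>s i \<omega>\<bar> \<le> 2 * \<bar>X \<omega>\<bar>"
    using borel_measurable_implies_sequence_metric[OF X(1), of 0] unfolding sp dist_real_def diff_0_right by blast
  obtain t where t: "\<And>i. simple_function G (t i)" "\<And>\<omega>. \<omega> \<in> space M \<Longrightarrow> (\<lambda>i. t i \<omega>) \<longlonglongrightarrow> Y \<omega>"
      "\<And>i \<omega>. \<omega> \<in> space M \<Longrightarrow> \<bar>t i \<omega>\<bar> \<le> 2 * \<bar>Y \<omega>\<bar>"
    using borel_measurable_implies_sequence_metric[OF Y(1), of 0] unfolding sp dist_real_def diff_0_right by blast
  have [measurable]: "s i \<in> borel_measurable M" "t i \<in> borel_measurable M" for i
    using borel_measurable_simple_function s(1) t(1) F G by (blast intro: measurable_from_subalg)+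
  have prod_lim: "(\<lambda>i. expectation (\<lambda>\<omega>. u i \<omega> * v i \<omega>)) \<longlonglongrightarrow> expectation (\<lambda>\<omega>. U \<omega> * V \<omega>)"
    if "integrable M (\<lambda>\<omega>. U \<omega> * V \<omega>)"
      and [measurable]: "\<And>i. u i \<in> borel_measurable M" "\<And>i. v i \<in> borel_measurable M"
        "U \<in> borel_measurable M" "V \<in> borel_measurable M"
      and u: "\<And>\<omega>. \<omega> \<in> space M \<Longrightarrow> (\<lambda>i. u i \<omega>) \<longlonglongrightarrow> U \<omega>"
        "\<And>i \<omega>. \<omega> \<in> space M \<Longrightarrow> \<bar>u i \<omega>\<bar> \<le> 2 * \<bar>U \<omega>\<bar>"
      and v: "\<And>\<omega>. \<omega> \<in> space M \<Longrightarrow> (\<lambda>i. v i \<omega>) \<longlonglongrightarrow> V \<omega>"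
        "\<And>i \<omega>. \<omega> \<in> space M \<Longrightarrow> \<bar>v i \<omega>\<bar> \<le> 2 * \<bar>V \<omega>\<bar>"
    for u v and U V :: "'a \<Rightarrow> real"
  proof (rule integral_dominated_convergence)
    show "integrable M (\<lambda>\<omega>. 4 * \<bar>U \<omega> * V \<omega>\<bar>)"
      using that(1) by auto
    show "AE \<omega> in M. norm (u i \<omega> * v i \<omega>) \<le> 4 * \<bar>U \<omega> * V \<omega>\<bar>" for i
    proof (rule AE_I2)
      fix \<omega> assume "\<omega> \<in> space M"
      then have "\<bar>u i \<omega>\<bar> * \<bar>v i \<omega>\<bar> \<le> (2 * \<bar>U \<omega>\<bar>) * (2 * \<bar>V \<omega>\<bar>)"
        using u v by (intro mult_mono) auto
      then show "norm (u i \<omega> * v i \<omega>) \<le> 4 * \<bar>U \<omega> * V \<omega>\<bar>" by (simp add: abs_mult)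
    qed
    show "AE \<omega> in M. (\<lambda>i. u i \<omega> * v i \<omega>) \<longlonglongrightarrow> U \<omega> * V \<omega>"
      using u v by (auto intro!: tendsto_mult)
  qed measurable
  have XY: "integrable M (\<lambda>\<omega>. X \<omega> * Y \<omega>)"
    using X Y by (intro integrable_mult_of_squares) auto
  have L1: "(\<lambda>i. expectation (\<lambda>\<omega>. s i \<omega> * t i \<omega>)) \<longlonglongrightarrow> expectation (\<lambda>\<omega>. X \<omega> * Y \<omega>)"
    using prod_lim[of X Y s t] XY s t by auto
  have L2: "(\<lambda>i. expectation (s i)) \<longlonglongrightarrow> expectation X"
    using prod_lim[of X "\<lambda>_. 1" s "\<lambda>_ _. 1"] intX s by auto
  have L3: "(\<lambda>i. expectation (t i)) \<longlonglongrightarrow> expectation Y"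
    using prod_lim[of Y "\<lambda>_. 1" t "\<lambda>_ _. 1"] intY t by auto
  have L4: "(\<lambda>i. expectation (\<lambda>\<omega>. (s i \<omega>)\<^sup>2)) \<longlonglongrightarrow> expectation (\<lambda>\<omega>. (X \<omega>)\<^sup>2)"
    using prod_lim[of X X s s] X s by (auto simp: power2_eq_square)
  have L5: "(\<lambda>i. expectation (\<lambda>\<omega>. (t i \<omega>)\<^sup>2)) \<longlonglongrightarrow> expectation (\<lambda>\<omega>. (Y \<omega>)\<^sup>2)"
    using prod_lim[of Y Y t t] Y t by (auto simp: power2_eq_square)
  have "(expectation (\<lambda>\<omega>. X \<omega> * Y \<omega>) - expectation X * expectation Y)\<^sup>2
      \<le> 4 * c * expectation (\<lambda>\<omega>. (X \<omega>)\<^sup>2) * expectation (\<lambda>\<omega>. (Y \<omega>)\<^sup>2)"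
  proof (rule LIMSEQ_le)
    show "(\<lambda>i. (expectation (\<lambda>\<omega>. s i \<omega> * t i \<omega>) - expectation (s i) * expectation (t i))\<^sup>2)
        \<longlonglongrightarrow> (expectation (\<lambda>\<omega>. X \<omega> * Y \<omega>) - expectation X * expectation Y)\<^sup>2"
      by (intro tendsto_intros L1 L2 L3)
    show "(\<lambda>i. 4 * c * expectation (\<lambda>\<omega>. (s i \<omega>)\<^sup>2) * expectation (\<lambda>\<omega>. (t i \<omega>)\<^sup>2))
        \<longlonglongrightarrow> 4 * c * expectation (\<lambda>\<omega>. (X \<omega>)\<^sup>2) * expectation (\<lambda>\<omega>. (Y \<omega>)\<^sup>2)"
      by (intro tendsto_intros L4 L5)
  qed (use covariance_le_simple[OF F G mix s(1) t(1)] in blast)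
  then have "\<bar>expectation (\<lambda>\<omega>. X \<omega> * Y \<omega>) - expectation X * expectation Y\<bar>
      \<le> sqrt (4 * c * expectation (\<lambda>\<omega>. (X \<omega>)\<^sup>2) * expectation (\<lambda>\<omega>. (Y \<omega>)\<^sup>2))"
    by (metis real_sqrt_abs real_sqrt_le_iff)
  then show ?thesis by (simp add: real_sqrt_mult)
qed

section \<open>Sums over lags by distance from the origin\<close>

definition lag_norm :: "int^'q \<Rightarrow> nat" where
  "lag_norm d = Max (range (\<lambda>k. nat \<bar>d $ k\<bar>))"

lemma lag_norm_le_iff: "lag_norm d \<le> r \<longleftrightarrow> (\<forall>k. \<bar>d $ k\<bar> \<le> int r)"
  by (auto simp: lag_norm_def nat_le_iff)

lemma abs_component_le_lag_norm: "\<bar>d $ k\<bar> \<le> int (lag_norm d)"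
  using lag_norm_le_iff by blast

lemma lag_norm_attained: obtains k where "\<bar>d $ k\<bar> = int (lag_norm d)"
proof -
  have "lag_norm d \<in> range (\<lambda>k. nat \<bar>d $ k\<bar>)"
    unfolding lag_norm_def by (intro Max_in) auto
  then show ?thesis using that by auto
qed

lemma bij_betw_vec_nth_box: "bij_betw vec_nth {i :: 'b^'q. \<forall>k. i $ k \<in> A k} (PiE UNIV A)"
  by (rule bij_betwI[where g = vec_lambda]) (auto simp: PiE_iff)

lemma card_vec_box: "card {i :: 'b^'q. \<forall>k. i $ k \<in> A k} = (\<Prod>k\<in>UNIV. card (A k))"
  using bij_betw_same_card[OF bij_betw_vec_nth_box[of A]] by (simp add: card_PiE)

lemma finite_vec_box: "(\<And>k. finite (A k)) \<Longrightarrow> finite {i :: 'b^'q. \<forall>k. i $ k \<in> A k}"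
  using bij_betw_finite[OF bij_betw_vec_nth_box[of A]] by (simp add: finite_PiE)

lemma lag_norm_ball_eq: "{d :: int^'q. lag_norm d \<le> r} = {d. \<forall>k. d $ k \<in> {- int r..int r}}"
  by (auto simp: lag_norm_le_iff abs_le_iff minus_le_iff)

lemma finite_lag_norm_ball: "finite {d :: int^'q. lag_norm d \<le> r}"
  unfolding lag_norm_ball_eq by (rule finite_vec_box) simp

lemma card_lag_norm_ball: "card {d :: int^'q. lag_norm d \<le> r} = (2 * r + 1) ^ CARD('q)"
proof -
  have "card {- int r..int r} = 2 * r + 1" by simp
  then show ?thesis unfolding lag_norm_ball_eq card_vec_box by (simp del: card_atLeastAtMost_int)
qed

lemma power_diff_le:
  fixes x y :: real
  assumes "0 \<le> y" "y \<le> x"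
  shows "x ^ Suc n - y ^ Suc n \<le> real (Suc n) * (x - y) * x ^ n"
proof (induction n)
  case (Suc n)
  have "x ^ Suc (Suc n) - y ^ Suc (Suc n) = x * (x ^ Suc n - y ^ Suc n) + (x - y) * y ^ Suc n"
    by (simp add: algebra_simps)
  also have "\<dots> \<le> x * (real (Suc n) * (x - y) * x ^ n) + (x - y) * x ^ Suc n"
    using assms by (intro add_mono mult_left_mono Suc.IH power_mono) auto
  finally show ?case by (simp add: algebra_simps)
qed (use assms in auto)

text \<open>
  A sphere is the difference of two consecutive balls, which are cubes with sides \<open>2 r + 3\<close> and
  \<open>2 r + 1\<close>. The difference of the two \<open>q\<close>-th powers is of order \<open>r\<^sup>q\<^sup>-\<^sup>1\<close>; this exponent is the one in
  the rate condition on the mixing coefficients.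
\<close>

lemma card_lag_norm_sphere_le:
  "real (card {d :: int^'q. lag_norm d = Suc r}) \<le> 2 * CARD('q) * real (2 * r + 3) ^ (CARD('q) - 1)"
proof -
  obtain q where q: "CARD('q) = Suc q" using zero_less_card_finite gr0_implies_Suc by blast
  have "{d :: int^'q. lag_norm d = Suc r} = {d. lag_norm d \<le> Suc r} - {d. lag_norm d \<le> r}"
    by auto
  moreover have "{d :: int^'q. lag_norm d \<le> r} \<subseteq> {d. lag_norm d \<le> Suc r}" by auto
  ultimately have "card {d :: int^'q. lag_norm d = Suc r} + (2 * r + 1) ^ Suc q = (2 * r + 3) ^ Suc q"
    using card_lag_norm_ball[of r, where ?'q = 'q] card_lag_norm_ball[of "Suc r", where ?'q = 'q]
      card_Diff_subset[OF finite_lag_norm_ball[of r, where ?'q = 'q], of "{d. lag_norm d \<le> Suc r}"]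
      card_mono[OF finite_lag_norm_ball[of "Suc r", where ?'q = 'q], of "{d. lag_norm d \<le> r}"]
    by (simp add: q eval_nat_numeral del: power_Suc)
  then have "real (card {d :: int^'q. lag_norm d = Suc r} + (2 * r + 1) ^ Suc q) = real ((2 * r + 3) ^ Suc q)"
    by (rule arg_cong)
  then have "real (card {d :: int^'q. lag_norm d = Suc r}) = real (2 * r + 3) ^ Suc q - real (2 * r + 1) ^ Suc q"
    unfolding of_nat_add of_nat_power by simp
  also have "\<dots> \<le> real (Suc q) * (real (2 * r + 3) - real (2 * r + 1)) * real (2 * r + 3) ^ q"
    by (rule power_diff_le) auto
  finally show ?thesis by (simp add: q algebra_simps)
qed

text \<open>
  Grouping by \<open>s = \<bar>d\<bar> - N\<close> leaves the sizes of the spheres of radius \<open>N + s\<close>, and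
  \<open>2 (N + s) + 1 \<le> (2 N + 3) s\<close> for \<open>s \<ge> 1\<close> separates the dependence on \<open>N\<close> from that on \<open>s\<close>.
\<close>

lemma sum_radial_le:
  fixes g :: "nat \<Rightarrow> real" and D :: "(int^'q) set"
  assumes "finite D" and g: "\<And>r. 0 \<le> g r"
    and sm: "summable (\<lambda>s. real (Suc s) ^ (CARD('q) - 1) * g (Suc s))"
  shows "(\<Sum>d\<in>{d\<in>D. N < lag_norm d}. g (lag_norm d - N)) \<le>
    2 * CARD('q) * real (2 * N + 3) ^ (CARD('q) - 1) *
      (\<Sum>s. real (Suc s) ^ (CARD('q) - 1) * g (Suc s))"
proof -
  define q where "q = CARD('q) - 1"
  define D' where "D' = {d\<in>D. N < lag_norm d}"
  have "finite D'" using assms by (simp add: D'_def)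
  define f where "f d = lag_norm d - Suc N" for d :: "int^'q"
  obtain L where L: "f ` D' \<subseteq> {..<L}"
    using finite_nat_iff_bounded \<open>finite D'\<close> by blast
  have "(\<Sum>d\<in>D'. g (lag_norm d - N)) = (\<Sum>s<L. \<Sum>d | d \<in> D' \<and> f d = s. g (lag_norm d - N))"
    using \<open>finite D'\<close> L by (subst sum.group) auto
  also have "\<dots> \<le> (\<Sum>s<L. 2 * CARD('q) * real (2 * N + 3) ^ q * (real (Suc s) ^ q * g (Suc s)))"
  proof (rule sum_mono)
    fix s
    have sub: "{d. d \<in> D' \<and> f d = s} \<subseteq> {d. lag_norm d = Suc (N + s)}"
      by (auto simp: D'_def f_def)
    have fin: "finite {d :: int^'q. lag_norm d = Suc (N + s)}"
      by (rule finite_subset[OF _ finite_lag_norm_ball[of "Suc (N + s)"]]) auto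
    have "(\<Sum>d | d \<in> D' \<and> f d = s. g (lag_norm d - N)) = (\<Sum>d | d \<in> D' \<and> f d = s. g (Suc s))"
      by (rule sum.cong) (auto simp: D'_def f_def intro!: arg_cong[of _ _ g])
    also have "\<dots> = real (card {d. d \<in> D' \<and> f d = s}) * g (Suc s)" by simp
    also have "\<dots> \<le> real (card {d :: int^'q. lag_norm d = Suc (N + s)}) * g (Suc s)"
      using g card_mono[OF fin sub] by (intro mult_right_mono) auto
    also have "\<dots> \<le> (2 * CARD('q) * real (2 * (N + s) + 3) ^ q) * g (Suc s)"
      using g unfolding q_def by (intro mult_right_mono card_lag_norm_sphere_le)
    also have "\<dots> \<le> (2 * CARD('q) * (real (2 * N + 3) * real (Suc s)) ^ q) * g (Suc s)"
    proof -
      have "2 * (N + s) + 3 \<le> (2 * N + 3) * Suc s" by (simp add: algebra_simps)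
      then have "real (2 * (N + s) + 3) \<le> real (2 * N + 3) * real (Suc s)"
        unfolding of_nat_mult[symmetric] of_nat_le_iff .
      then show ?thesis using g by (intro mult_right_mono mult_left_mono power_mono) auto
    qed
    finally show "(\<Sum>d | d \<in> D' \<and> f d = s. g (lag_norm d - N)) \<le>
        2 * CARD('q) * real (2 * N + 3) ^ q * (real (Suc s) ^ q * g (Suc s))"
      by (simp add: power_mult_distrib mult_ac)
  qed
  also have "\<dots> = 2 * CARD('q) * real (2 * N + 3) ^ q * (\<Sum>s<L. real (Suc s) ^ q * g (Suc s))"
    by (simp add: sum_distrib_left)
  also have "\<dots> \<le> 2 * CARD('q) * real (2 * N + 3) ^ q * (\<Sum>s. real (Suc s) ^ q * g (Suc s))"
    using sm g unfolding q_def by (intro mult_left_mono sum_le_suminf) auto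
  finally show ?thesis by (simp add: D'_def q_def)
qed

text \<open>
  With truncated subtraction, all lags of norm at most \<open>N\<close> contribute \<open>g 0\<close>. For \<open>N = 0\<close> this is
  summability over the lattice; for general \<open>N\<close> it describes covariances that decay only from
  distance \<open>N\<close> on.
\<close>

corollary sum_radial_shift_le:
  fixes g :: "nat \<Rightarrow> real" and D :: "(int^'q) set"
  assumes "finite D" and g: "\<And>r. 0 \<le> g r"
    and sm: "summable (\<lambda>s. real (Suc s) ^ (CARD('q) - 1) * g (Suc s))"
  shows "(\<Sum>d\<in>D. g (lag_norm d - N)) \<le>
    (g 0 + 2 * CARD('q) * (\<Sum>s. real (Suc s) ^ (CARD('q) - 1) * g (Suc s))) * real (2 * N + 3) ^ CARD('q)"
proof -
  let ?S = "\<Sum>s. real (Suc s) ^ (CARD('q) - 1) * g (Suc s)"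
  have S: "0 \<le> ?S" using g sm by (intro suminf_nonneg) auto
  have "(\<Sum>d\<in>D. g (lag_norm d - N)) =
      (\<Sum>d\<in>{d\<in>D. \<not> N < lag_norm d}. g (lag_norm d - N)) + (\<Sum>d\<in>{d\<in>D. N < lag_norm d}. g (lag_norm d - N))"
    using \<open>finite D\<close> by (subst sum.union_disjoint[symmetric]) (auto intro!: sum.cong)
  also have "(\<Sum>d\<in>{d\<in>D. \<not> N < lag_norm d}. g (lag_norm d - N)) = real (card {d\<in>D. \<not> N < lag_norm d}) * g 0"
    by simp
  also have "\<dots> \<le> real (2 * N + 3) ^ CARD('q) * g 0"
  proof (intro mult_right_mono g)
    have "card {d\<in>D. \<not> N < lag_norm d} \<le> card {d :: int^'q. lag_norm d \<le> N}"
      by (intro card_mono finite_lag_norm_ball) auto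
    also have "\<dots> \<le> (2 * N + 3) ^ CARD('q)"
      unfolding card_lag_norm_ball by (intro power_mono) auto
    finally show "real (card {d\<in>D. \<not> N < lag_norm d}) \<le> real (2 * N + 3) ^ CARD('q)"
      by (metis of_nat_le_iff of_nat_power)
  qed
  also have "(\<Sum>d\<in>{d\<in>D. N < lag_norm d}. g (lag_norm d - N)) \<le>
      2 * CARD('q) * real (2 * N + 3) ^ (CARD('q) - 1) * ?S"
    using assms by (rule sum_radial_le)
  also have "\<dots> \<le> 2 * CARD('q) * real (2 * N + 3) ^ CARD('q) * ?S"
    using S by (intro mult_right_mono mult_left_mono power_increasing) auto
  finally show ?thesis by (simp add: algebra_simps)
qed

section \<open>Observation boxes and lag windows\<close>

lemma min_comp_le: "min_comp n \<le> n $ k"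
  by (simp add: min_comp_def)

lemma le_max_comp: "n $ k \<le> max_comp n"
  by (simp add: max_comp_def)

lemma min_comp_le_max_comp: "min_comp n \<le> max_comp n"
  using min_comp_le le_max_comp by (rule order_trans)

lemma lag_window_subset_ball: "lag_window m \<subseteq> {j. lag_norm j \<le> max_comp m}"
proof -
  have "int (m $ k) \<le> int (max_comp m)" for k
    using le_max_comp by (rule of_nat_mono)
  then show ?thesis by (auto simp: lag_window_def lag_norm_le_iff intro: order_trans)
qed

lemma finite_lag_window: "finite (lag_window m)"
  using lag_window_subset_ball finite_lag_norm_ball by (rule finite_subset)

lemma card_lag_window_le: "card (lag_window (m :: nat^'q)) \<le> (2 * max_comp m + 1) ^ CARD('q)"
  using card_mono[OF finite_lag_norm_ball lag_window_subset_ball] by (simp add: card_lag_norm_ball)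

text \<open>
  In the form of a product of intervals the set can be counted coordinatewise; the interval in
  direction \<open>k\<close> has \<open>n\<^sub>k - \<bar>j\<^sub>k\<bar>\<close> elements when \<open>\<bar>j\<^sub>k\<bar> \<le> n\<^sub>k\<close>.
\<close>

lemma Gamma_shift_eq_box:
  "Gamma_shift n j = {i. \<forall>k. i $ k \<in> {max 1 (1 - j $ k)..min (int (n $ k)) (int (n $ k) - j $ k)}}"
proof -
  have "(i \<in> Gamma_shift n j) = (\<forall>k. i $ k \<in> {max 1 (1 - j $ k)..min (int (n $ k)) (int (n $ k) - j $ k)})" for i
  proof -
    have "(1 \<le> x \<and> x \<le> N) \<and> 1 \<le> x + y \<and> x + y \<le> N \<longleftrightarrow> x \<in> {max 1 (1 - y)..min N (N - y)}"
      for x y N :: int by auto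
    then show ?thesis
      unfolding Gamma_shift_def Gamma_set_def by (simp only: mem_Collect_eq vector_add_component all_conj_distrib[symmetric])
  qed
  then show ?thesis by blast
qed

lemma finite_Gamma_shift: "finite (Gamma_shift n j)"
  unfolding Gamma_shift_eq_box by (rule finite_vec_box) simp

lemma card_Gamma_shift_ge:
  fixes n :: "nat^'q"
  assumes "lag_norm j \<le> r"
  shows "(min_comp n - r) ^ CARD('q) \<le> card (Gamma_shift n j)"
proof -
  have "(min_comp n - r) ^ CARD('q) = (\<Prod>k\<in>(UNIV :: 'q set). min_comp n - r)" by simp
  also have "\<dots> \<le> card (Gamma_shift n j)"
    unfolding Gamma_shift_eq_box card_vec_box
  proof (rule prod_mono, intro conjI)
    fix k :: 'q
    have "\<bar>j $ k\<bar> \<le> int r" using assms lag_norm_le_iff by blast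
    then show "min_comp n - r \<le> card {max 1 (1 - j $ k)..min (int (n $ k)) (int (n $ k) - j $ k)}"
      using min_comp_le[of n k] by auto
  qed simp
  finally show ?thesis .
qed

lemma filterlim_min_comp: "filterlim min_comp at_top multi_at_top"
  by (simp add: multi_at_top_def filterlim_filtercomap)

lemma eventually_subset_lag_window:
  fixes F :: "(int^'q) set"
  assumes "finite F"
  shows "eventually (\<lambda>m. F \<subseteq> lag_window m) multi_at_top"
proof -
  obtain r where r: "lag_norm ` F \<subseteq> {..<r}"
    using assms finite_nat_iff_bounded by blast
  have "eventually (\<lambda>m :: nat^'q. r \<le> min_comp m) multi_at_top"
    using filterlim_min_comp by (auto simp: filterlim_at_top)
  then show ?thesis
  proof eventually_elim
    case (elim m)
    have "\<bar>j $ k\<bar> \<le> int (m $ k)" if "j \<in> F" for j k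
    proof -
      have "lag_norm j < r" using r that by auto
      then show ?thesis
        using elim min_comp_le[of m k] abs_component_le_lag_norm[of j k] by linarith
    qed
    then show ?case by (auto simp: lag_window_def)
  qed
qed

text \<open>
  Dominated convergence for series over the lattice: outside a finite set \<open>F\<close> of lags the norms of
  \<open>g\<close> have a small sum, and on \<open>F\<close> the weights converge to \<open>1\<close>.
\<close>

lemma tendsto_weighted_sum_lag_window:
  fixes g :: "int^'q \<Rightarrow> 'v::banach" and w :: "nat^'q \<Rightarrow> int^'q \<Rightarrow> real"
  assumes sm: "(\<lambda>j. norm (g j)) summable_on UNIV"
    and W1: "\<And>j. ((\<lambda>k. w k j) \<longlongrightarrow> 1) multi_at_top"
    and W2: "\<And>k j. \<bar>w k j\<bar> \<le> C"
  shows "((\<lambda>m. \<Sum>j\<in>lag_window m. w m j *\<^sub>R g j) \<longlongrightarrow> (\<Sum>\<^sub>\<infinity>j. g j)) multi_at_top"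
proof (rule tendstoI)
  fix e :: real assume "0 < e"
  have "0 \<le> C" using W2[of undefined undefined] by simp
  have sg: "g summable_on UNIV" using sm by (rule abs_summable_summable)
  \<comment> \<open>the tail enters once with the weights, bounded by \<open>C\<close>, and once without\<close>
  define e1 where "e1 = e / (2 * (C + 1))"
  have "0 < e1" using \<open>0 < e\<close> \<open>0 \<le> C\<close> by (simp add: e1_def)
  obtain F where F: "finite F" and Fe: "dist (\<Sum>j\<in>F. norm (g j)) (\<Sum>\<^sub>\<infinity>j. norm (g j)) < e1"
    using tendstoD[OF infsum_tendsto[OF sm] \<open>0 < e1\<close>] unfolding eventually_finite_subsets_at_top by blast
  have tail: "(\<lambda>j. norm (g j)) summable_on - F"
    using sm by (rule summable_on_subset_banach) auto
  have tail_le: "(\<Sum>\<^sub>\<infinity>j\<in>-F. norm (g j)) < e1"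
  proof -
    have "(\<Sum>\<^sub>\<infinity>j. norm (g j)) = (\<Sum>j\<in>F. norm (g j)) + (\<Sum>\<^sub>\<infinity>j\<in>-F. norm (g j))"
      using infsum_Un_disjoint[of "\<lambda>j. norm (g j)" F "-F"] tail F by simp
    then show ?thesis using Fe by (simp add: dist_real_def)
  qed
  have "((\<lambda>m. \<Sum>j\<in>F. (w m j - 1) *\<^sub>R g j) \<longlongrightarrow> (\<Sum>j\<in>F. (1 - 1) *\<^sub>R g j)) multi_at_top"
    by (intro tendsto_intros W1)
  then have "eventually (\<lambda>m. norm (\<Sum>j\<in>F. (w m j - 1) *\<^sub>R g j) < e / 2) multi_at_top"
    using \<open>0 < e\<close> by (auto dest: tendstoD[of _ _ _ "e / 2"])
  with eventually_subset_lag_window[OF F]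
  show "eventually (\<lambda>m. dist (\<Sum>j\<in>lag_window m. w m j *\<^sub>R g j) (\<Sum>\<^sub>\<infinity>j. g j) < e) multi_at_top"
  proof eventually_elim
    case (elim m)
    have split1: "(\<Sum>j\<in>lag_window m. w m j *\<^sub>R g j) =
        (\<Sum>j\<in>F. w m j *\<^sub>R g j) + (\<Sum>j\<in>lag_window m - F. w m j *\<^sub>R g j)"
      unfolding sum.subset_diff[OF elim(1) finite_lag_window] by (rule add.commute)
    have split2: "(\<Sum>\<^sub>\<infinity>j. g j) = (\<Sum>j\<in>F. g j) + (\<Sum>\<^sub>\<infinity>j\<in>-F. g j)"
      using infsum_Un_disjoint[of g F "-F"] abs_summable_summable[OF tail] F by simp
    have "norm (\<Sum>j\<in>lag_window m - F. w m j *\<^sub>R g j) \<le> (\<Sum>j\<in>lag_window m - F. C * norm (g j))"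
      using W2 by (intro sum_norm_le) (auto intro!: mult_right_mono)
    also have "\<dots> = C * (\<Sum>j\<in>lag_window m - F. norm (g j))" by (simp add: sum_distrib_left)
    also have "\<dots> \<le> C * (\<Sum>\<^sub>\<infinity>j\<in>-F. norm (g j))"
      using \<open>0 \<le> C\<close> tail finite_lag_window by (intro mult_left_mono finite_sum_le_infsum) auto
    finally have 1: "norm (\<Sum>j\<in>lag_window m - F. w m j *\<^sub>R g j) \<le> C * (\<Sum>\<^sub>\<infinity>j\<in>-F. norm (g j))" .
    have 2: "norm (\<Sum>\<^sub>\<infinity>j\<in>-F. g j) \<le> (\<Sum>\<^sub>\<infinity>j\<in>-F. norm (g j))"
      using tail by (rule norm_infsum_bound)
    have "(C + 1) * (\<Sum>\<^sub>\<infinity>j\<in>-F. norm (g j)) < (C + 1) * e1"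
      using tail_le \<open>0 \<le> C\<close> by (intro mult_strict_left_mono) auto
    also have "\<dots> = e / 2"
    proof -
      have "c * (e / (2 * c)) = e / 2" if "c \<noteq> 0" for c :: real using that by simp
      moreover have "C + 1 \<noteq> 0" using \<open>0 \<le> C\<close> by linarith
      ultimately show ?thesis unfolding e1_def by blast
    qed
    finally have 3: "(C + 1) * (\<Sum>\<^sub>\<infinity>j\<in>-F. norm (g j)) < e / 2" .
    have "(\<Sum>j\<in>lag_window m. w m j *\<^sub>R g j) - (\<Sum>\<^sub>\<infinity>j. g j) =
        (\<Sum>j\<in>F. (w m j - 1) *\<^sub>R g j) + ((\<Sum>j\<in>lag_window m - F. w m j *\<^sub>R g j) - (\<Sum>\<^sub>\<infinity>j\<in>-F. g j))"
      unfolding split1 split2 by (simp add: scaleR_left_diff_distrib sum_subtractf)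
    also have "norm \<dots> \<le>
        norm (\<Sum>j\<in>F. (w m j - 1) *\<^sub>R g j) +
        (norm (\<Sum>j\<in>lag_window m - F. w m j *\<^sub>R g j) + norm (\<Sum>\<^sub>\<infinity>j\<in>-F. g j))"
      by (intro order_trans[OF norm_triangle_ineq] add_left_mono norm_triangle_ineq4)
    finally show ?case using elim(2) 1 2 3 unfolding dist_norm by (simp add: algebra_simps)
  qed
qed

section \<open>Vector-valued integrals and convergence in probability\<close>

lemma integrable_vec_componentwise:
  fixes X :: "'a \<Rightarrow> real^'p"
  assumes "X \<in> borel_measurable M" "\<And>a. integrable M (\<lambda>\<omega>. X \<omega> $ a)"
  shows "integrable M X"
proof (rule Bochner_Integration.integrable_bound)
  show "integrable M (\<lambda>\<omega>. \<Sum>a\<in>UNIV. \<bar>X \<omega> $ a\<bar>)" using assms by simp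
  show "AE \<omega> in M. norm (X \<omega>) \<le> norm (\<Sum>a\<in>UNIV. \<bar>X \<omega> $ a\<bar>)"
    using norm_le_l1_cart by (auto intro!: AE_I2 order_trans[OF _ abs_ge_self])
qed (use assms in simp)

text \<open>
  Expanding the matrix in the standard basis deduces its Bochner integrability from that of the
  entries.
\<close>

lemma integral_matrix_component:
  fixes A :: "'a \<Rightarrow> real^'p^'p"
  assumes "\<And>a b. integrable M (\<lambda>\<omega>. A \<omega> $ a $ b)"
  shows "(\<integral>\<omega>. A \<omega> \<partial>M) $ a $ b = (\<integral>\<omega>. A \<omega> $ a $ b \<partial>M)"
proof -
  have "B = (\<Sum>z\<in>UNIV. (B $ fst z $ snd z) *\<^sub>R axis (fst z) (axis (snd z) 1))" for B :: "real^'p^'p"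
  proof -
    have "(axis (fst z) (axis (snd z) 1) :: real^'p^'p) $ a $ b = (if z = (a, b) then 1 else 0)" for z a b
      by (auto simp: axis_def prod_eq_iff)
    then show ?thesis
      by (simp add: vec_eq_iff if_distrib[where f = "\<lambda>x. _ * x"] cong: if_cong)
  qed
  then have eq: "A = (\<lambda>\<omega>. \<Sum>z\<in>UNIV. (A \<omega> $ fst z $ snd z) *\<^sub>R axis (fst z) (axis (snd z) 1))"
    by (rule ext)
  have "integrable M (\<lambda>\<omega>. \<Sum>z\<in>UNIV. (A \<omega> $ fst z $ snd z) *\<^sub>R (axis (fst z) (axis (snd z) 1) :: real^'p^'p))"
    by (intro Bochner_Integration.integrable_sum integrable_scaleR_left assms)
  then have A: "integrable M A" by (rule ssubst[OF eq, of "integrable M"])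
  have "bounded_linear (\<lambda>B :: real^'p^'p. B $ a $ b)"
    using bounded_linear_compose[OF bounded_linear_vec_nth bounded_linear_vec_nth] .
  from integral_bounded_linear[OF this A] show ?thesis by simp
qed

lemma measurable_vec_coordinate:
  "i \<in> I \<Longrightarrow> (\<lambda>x. x i $ a) \<in> borel_measurable (\<Pi>\<^sub>M i\<in>I. borel :: (real^'p) measure)"
  by (rule measurable_compose[OF measurable_component_singleton[where M = "\<lambda>_. borel"] borel_measurable_nth])

lemma mat_supnorm_nonneg: "0 \<le> mat_supnorm A"
proof -
  obtain a where "a \<in> range (\<lambda>(a, b). \<bar>A $ a $ b\<bar>)" by blast
  then show ?thesis unfolding mat_supnorm_def by (intro order_trans[OF _ Max_ge]) auto
qed

lemma mat_supnorm_add_le: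
  "mat_supnorm (A + B) \<le> (\<Sum>a\<in>UNIV. \<Sum>b\<in>UNIV. \<bar>A $ a $ b\<bar>) + norm B"
proof -
  have "\<bar>(A + B) $ a $ b\<bar> \<le> (\<Sum>a\<in>UNIV. \<Sum>b\<in>UNIV. \<bar>A $ a $ b\<bar>) + norm B" for a b
  proof -
    have "\<bar>A $ a $ b\<bar> \<le> (\<Sum>b\<in>UNIV. \<bar>A $ a $ b\<bar>)" by (intro member_le_sum) auto
    also have "\<dots> \<le> (\<Sum>a\<in>UNIV. \<Sum>b\<in>UNIV. \<bar>A $ a $ b\<bar>)"
      by (rule member_le_sum) (auto intro: sum_nonneg)
    finally have 1: "\<bar>A $ a $ b\<bar> \<le> \<dots>" .
    have 2: "\<bar>B $ a $ b\<bar> \<le> norm B"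
      by (rule order_trans[OF component_le_norm_cart Finite_Cartesian_Product.norm_nth_le])
    show ?thesis using abs_triangle_ineq[of "A $ a $ b" "B $ a $ b"] 1 2 by simp
  qed
  then show ?thesis by (auto simp: mat_supnorm_def)
qed

lemma (in prob_space) expectation_abs_le_sqrt:
  fixes Z :: "'a \<Rightarrow> real"
  assumes [measurable]: "Z \<in> borel_measurable M" and "integrable M (\<lambda>\<omega>. (Z \<omega>)\<^sup>2)"
  shows "expectation (\<lambda>\<omega>. \<bar>Z \<omega>\<bar>) \<le> sqrt (expectation (\<lambda>\<omega>. (Z \<omega>)\<^sup>2))"
proof (rule real_le_rsqrt)
  have "integrable M Z" using assms by (rule square_integrable_imp_integrable)
  then have "variance (\<lambda>\<omega>. \<bar>Z \<omega>\<bar>) = expectation (\<lambda>\<omega>. \<bar>Z \<omega>\<bar>\<^sup>2) - (expectation (\<lambda>\<omega>. \<bar>Z \<omega>\<bar>))\<^sup>2"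
    using assms by (intro variance_eq) auto
  moreover have "0 \<le> variance (\<lambda>\<omega>. \<bar>Z \<omega>\<bar>)" by (intro Bochner_Integration.integral_nonneg) auto
  ultimately show "(expectation (\<lambda>\<omega>. \<bar>Z \<omega>\<bar>))\<^sup>2 \<le> expectation (\<lambda>\<omega>. (Z \<omega>)\<^sup>2)" by simp
qed

text \<open>
  Measurability is asked of the dominating variables, to which Markov's inequality is applied.
\<close>

lemma (in prob_space) tendsto_in_prob_of_dominating_mean:
  assumes dom: "eventually (\<lambda>n. integrable M (Y n) \<and> (\<forall>\<omega>\<in>space M. \<bar>X n \<omega>\<bar> \<le> Y n \<omega>) \<and>
      expectation (Y n) \<le> c n) F"
    and c: "(c \<longlongrightarrow> 0) F"
  shows "tendsto_in_prob M X 0 F"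
  unfolding tendsto_in_prob_def
proof (intro allI impI)
  fix \<epsilon> :: real assume "0 < \<epsilon>"
  have lim: "((\<lambda>n. c n / \<epsilon>) \<longlongrightarrow> 0) F"
    using tendsto_divide[OF c tendsto_const[of \<epsilon>]] \<open>0 < \<epsilon>\<close> by simp
  show "((\<lambda>n. prob {\<omega> \<in> space M. \<epsilon> < \<bar>X n \<omega> - 0\<bar>}) \<longlongrightarrow> 0) F"
  proof (rule tendsto_sandwich[OF _ _ tendsto_const lim])
    from dom show "eventually (\<lambda>n. prob {\<omega> \<in> space M. \<epsilon> < \<bar>X n \<omega> - 0\<bar>} \<le> c n / \<epsilon>) F"
    proof eventually_elim
      case (elim n)
      then have [measurable]: "Y n \<in> borel_measurable M" by auto
      have "prob {\<omega> \<in> space M. \<epsilon> < \<bar>X n \<omega> - 0\<bar>} \<le> prob {\<omega> \<in> space M. \<epsilon> \<le> Y n \<omega>}"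
        using elim by (intro finite_measure_mono) force+
      also have "\<dots> \<le> expectation (Y n) / \<epsilon>"
        using elim \<open>0 < \<epsilon>\<close>
        by (intro integral_Markov_inequality_measure[where A = "{}"]) (auto intro!: AE_I2 order_trans[OF abs_ge_zero])
      also have "\<dots> \<le> c n / \<epsilon>" using elim \<open>0 < \<epsilon>\<close> by (intro divide_right_mono) auto
      finally show ?case .
    qed
  qed (simp add: always_eventually)
qed

section \<open>Covariances in a stationary mixing field\<close>

locale stationary_field = prob_space M for M :: "'a measure" +
  fixes \<xi> :: "int^'q \<Rightarrow> 'a \<Rightarrow> real^'p"
  assumes field: "random_field M \<xi>" and stationary: "strictly_stationary M \<xi>"
begin

definition field_algebra :: "(int^'q) set \<Rightarrow> 'a measure" where
  "field_algebra I = sigma (space M) {\<xi> i -` B \<inter> space M | i B. i \<in> I \<and> B \<in> sets borel}"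

lemma measurable_field [measurable]: "\<xi> i \<in> borel_measurable M"
  using field by (simp add: random_field_def)

lemma space_field_algebra: "space (field_algebra I) = space M"
  and sets_field_algebra: "sets (field_algebra I) = generated_events M \<xi> I"
  unfolding field_algebra_def generated_events_def
  by (subst space_measure_of sets_measure_of; force)+

lemma subalgebra_field_algebra: "subalgebra M (field_algebra I)"
  unfolding subalgebra_def space_field_algebra sets_field_algebra generated_events_def
  by (auto intro!: sets.sigma_sets_subset measurable_sets[OF measurable_field])

lemma measurable_field_algebra: "i \<in> I \<Longrightarrow> \<xi> i \<in> borel_measurable (field_algebra I)"
  by (rule measurableI)
    (auto simp: space_field_algebra sets_field_algebra generated_events_def intro!: sigma_sets.Basic)

text \<open>
  Multiplying by \<open>P(A)\<close> removes the conditional probability and makes the estimate meaningful, and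
  trivial, for null events \<open>A\<close>.
\<close>

lemma phi_dir_bound:
  assumes A: "A \<in> A_minus M \<xi> k 0" and B: "B \<in> A_plus M \<xi> k r"
  shows "\<bar>prob (A \<inter> B) - prob A * prob B\<bar> \<le> phi_dir M \<xi> k r * prob A"
proof (cases "prob A = 0")
  case True
  have "A \<in> events"
    using A subalgebra_field_algebra
    by (auto simp: A_minus_def sets_field_algebra[symmetric] subalgebra_def)
  then have "prob (A \<inter> B) \<le> prob A"
    by (intro finite_measure_mono) auto
  then show ?thesis using True by (simp add: measure_le_0_iff)
next
  case False
  then have pos: "prob A > 0" by (simp add: zero_less_measure_iff)
  have ev: "A \<in> events" "B \<in> events"
    using A B subalgebra_field_algebra
    by (auto simp: A_minus_def A_plus_def sets_field_algebra[symmetric] subalgebra_def)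
  let ?S = "{\<bar>cond_prob M (\<lambda>\<omega>. \<omega> \<in> B) (\<lambda>\<omega>. \<omega> \<in> A) - prob B\<bar> | A B.
           A \<in> A_minus M \<xi> k 0 \<and> B \<in> A_plus M \<xi> k r \<and> prob A > 0}"
  have bdd: "bdd_above ?S"
  proof (rule bdd_aboveI, clarify)
    fix A B
    assume "A \<in> A_minus M \<xi> k 0" "B \<in> A_plus M \<xi> k r" "prob A > 0"
    then have ev: "A \<in> events"
      using subalgebra_field_algebra
      by (auto simp: A_minus_def sets_field_algebra[symmetric] subalgebra_def)
    have "prob {\<omega> \<in> space M. \<omega> \<in> B \<and> \<omega> \<in> A} \<le> prob {\<omega> \<in> space M. \<omega> \<in> A}"
      using ev by (intro finite_measure_mono) auto
    then have "cond_prob M (\<lambda>\<omega>. \<omega> \<in> B) (\<lambda>\<omega>. \<omega> \<in> A) \<le> 1"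
      by (simp add: cond_prob_def divide_le_eq_1 zero_less_measure_iff)
    moreover have "0 \<le> cond_prob M (\<lambda>\<omega>. \<omega> \<in> B) (\<lambda>\<omega>. \<omega> \<in> A)" by (simp add: cond_prob_def)
    ultimately show "\<bar>cond_prob M (\<lambda>\<omega>. \<omega> \<in> B) (\<lambda>\<omega>. \<omega> \<in> A) - prob B\<bar> \<le> 1"
      using prob_le_1[of B] measure_nonneg[of M B] by linarith
  qed
  have "{\<omega> \<in> space M. \<omega> \<in> B \<and> \<omega> \<in> A} = A \<inter> B" "{\<omega> \<in> space M. \<omega> \<in> A} = A"
    using ev sets.sets_into_space by auto
  then have "cond_prob M (\<lambda>\<omega>. \<omega> \<in> B) (\<lambda>\<omega>. \<omega> \<in> A) = prob (A \<inter> B) / prob A"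
    by (simp add: cond_prob_def)
  moreover have "\<bar>cond_prob M (\<lambda>\<omega>. \<omega> \<in> B) (\<lambda>\<omega>. \<omega> \<in> A) - prob B\<bar> \<le> phi_dir M \<xi> k r"
    unfolding phi_dir_def using A B pos by (intro cSup_upper bdd) blast
  ultimately have "\<bar>prob (A \<inter> B) / prob A - prob B\<bar> * prob A \<le> phi_dir M \<xi> k r * prob A"
    using pos by (intro mult_right_mono) auto
  moreover have "\<bar>prob (A \<inter> B) / prob A - prob B\<bar> * prob A = \<bar>(prob (A \<inter> B) / prob A - prob B) * prob A\<bar>"
    using pos by (simp add: abs_mult)
  moreover have "(prob (A \<inter> B) / prob A - prob B) * prob A = prob (A \<inter> B) - prob A * prob B"
    using pos by (simp add: field_simps)
  ultimately show ?thesis by simp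
qed

lemma phi_coeff_bound:
  assumes "0 < r" "A \<in> A_minus M \<xi> k 0" "B \<in> A_plus M \<xi> k r"
  shows "\<bar>prob (A \<inter> B) - prob A * prob B\<bar> \<le> phi_coeff M \<xi> r * prob A"
proof -
  have "phi_dir M \<xi> k r \<le> phi_coeff M \<xi> r"
    using \<open>0 < r\<close> by (simp add: phi_coeff_def)
  then show ?thesis
    by (intro order_trans[OF phi_dir_bound[OF assms(2,3)]] mult_right_mono) auto
qed

lemma phi_coeff_nonneg: "0 \<le> phi_coeff M \<xi> r"
proof (cases "r = 0")
  case False
  have "space M \<in> generated_events M \<xi> I" for I
    using sets.top[of "field_algebra I"] by (simp add: space_field_algebra sets_field_algebra)
  then have "\<bar>prob (space M \<inter> space M) - prob (space M) * prob (space M)\<bar> \<le> phi_coeff M \<xi> r * prob (space M)"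
    using False by (intro phi_coeff_bound) (auto simp: A_minus_def A_plus_def)
  then show ?thesis by (simp add: prob_space)
qed (simp add: phi_coeff_def)

lemma
  fixes h :: "(int^'q \<Rightarrow> real^'p) \<Rightarrow> real"
  assumes "finite J" and h: "h \<in> borel_measurable (Pi\<^sub>M J (\<lambda>_. borel))"
  shows expectation_shift:
      "expectation (\<lambda>\<omega>. h (\<lambda>i\<in>J. \<xi> (i + v) \<omega>)) = expectation (\<lambda>\<omega>. h (\<lambda>i\<in>J. \<xi> i \<omega>))"
    and integrable_shift:
      "integrable M (\<lambda>\<omega>. h (\<lambda>i\<in>J. \<xi> (i + v) \<omega>)) \<longleftrightarrow> integrable M (\<lambda>\<omega>. h (\<lambda>i\<in>J. \<xi> i \<omega>))"
proof -
  have eq: "distr M (\<Pi>\<^sub>M i\<in>J. borel) (\<lambda>\<omega>. \<lambda>i\<in>J. \<xi> (i + v) \<omega>) =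
      distr M (\<Pi>\<^sub>M i\<in>J. borel) (\<lambda>\<omega>. \<lambda>i\<in>J. \<xi> i \<omega>)"
    using stationary \<open>finite J\<close> unfolding strictly_stationary_def by blast
  have m: "(\<lambda>\<omega>. \<lambda>i\<in>J. \<xi> (f i) \<omega>) \<in> M \<rightarrow>\<^sub>M (\<Pi>\<^sub>M i\<in>J. borel)" for f
    by (intro measurable_restrict measurable_field)
  show "expectation (\<lambda>\<omega>. h (\<lambda>i\<in>J. \<xi> (i + v) \<omega>)) = expectation (\<lambda>\<omega>. h (\<lambda>i\<in>J. \<xi> i \<omega>))"
    using arg_cong[OF eq, of "\<lambda>N. integral\<^sup>L N h"] by (simp only: integral_distr[OF m h])
  show "integrable M (\<lambda>\<omega>. h (\<lambda>i\<in>J. \<xi> (i + v) \<omega>)) \<longleftrightarrow> integrable M (\<lambda>\<omega>. h (\<lambda>i\<in>J. \<xi> i \<omega>))"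
    using arg_cong[OF eq, of "\<lambda>N. integrable N h"] by (simp only: integrable_distr_eq[OF m h])
qed

text \<open>
  The mixing coefficients compare the half-spaces \<open>n\<^sub>k \<le> 0\<close> and \<open>n\<^sub>k \<ge> r\<close> only. By stationarity the
  moments do not change when all sites are translated, and a translation moves \<open>I\<close> and \<open>J\<close> into these
  half-spaces.
\<close>

lemma covariance_le_directed:
  fixes f g :: "(int^'q \<Rightarrow> real^'p) \<Rightarrow> real"
  assumes fin: "finite I" "finite J" and "0 < r"
    and I: "\<And>i. i \<in> I \<Longrightarrow> i $ k \<le> s" and J: "\<And>j. j \<in> J \<Longrightarrow> s + int r \<le> j $ k"
    and f: "f \<in> borel_measurable (Pi\<^sub>M I (\<lambda>_. borel))" and g: "g \<in> borel_measurable (Pi\<^sub>M J (\<lambda>_. borel))"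
    and f2: "integrable M (\<lambda>\<omega>. (f (\<lambda>i\<in>I. \<xi> i \<omega>))\<^sup>2)" and g2: "integrable M (\<lambda>\<omega>. (g (\<lambda>j\<in>J. \<xi> j \<omega>))\<^sup>2)"
  shows "\<bar>expectation (\<lambda>\<omega>. f (\<lambda>i\<in>I. \<xi> i \<omega>) * g (\<lambda>j\<in>J. \<xi> j \<omega>)) -
      expectation (\<lambda>\<omega>. f (\<lambda>i\<in>I. \<xi> i \<omega>)) * expectation (\<lambda>\<omega>. g (\<lambda>j\<in>J. \<xi> j \<omega>))\<bar>
    \<le> 2 * sqrt (phi_coeff M \<xi> r) * sqrt (expectation (\<lambda>\<omega>. (f (\<lambda>i\<in>I. \<xi> i \<omega>))\<^sup>2)) *
        sqrt (expectation (\<lambda>\<omega>. (g (\<lambda>j\<in>J. \<xi> j \<omega>))\<^sup>2))"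
proof -
  \<comment> \<open>only the coordinate \<open>k\<close> matters; shifting all coordinates by the same amount is simplest\<close>
  define v :: "int^'q" where "v = (\<chi> l. - s)"
  define X where "X \<omega> = f (\<lambda>i\<in>I. \<xi> (i + v) \<omega>)" for \<omega>
  define Y where "Y \<omega> = g (\<lambda>j\<in>J. \<xi> (j + v) \<omega>)" for \<omega>
  let ?F = "field_algebra {n. n $ k \<le> int 0}" and ?G = "field_algebra {n. int r \<le> n $ k}"
  have "(\<lambda>\<omega>. \<lambda>i\<in>I. \<xi> (i + v) \<omega>) \<in> ?F \<rightarrow>\<^sub>M (\<Pi>\<^sub>M i\<in>I. borel)"
    using I by (intro measurable_restrict measurable_field_algebra) (auto simp: v_def)
  then have X: "X \<in> borel_measurable ?F"
    unfolding X_def by (rule measurable_compose[OF _ f])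
  have "(\<lambda>\<omega>. \<lambda>j\<in>J. \<xi> (j + v) \<omega>) \<in> ?G \<rightarrow>\<^sub>M (\<Pi>\<^sub>M j\<in>J. borel)"
    using J by (intro measurable_restrict measurable_field_algebra) (force simp: v_def)
  then have Y: "Y \<in> borel_measurable ?G"
    unfolding Y_def by (rule measurable_compose[OF _ g])
  have f2m: "(\<lambda>x. (f x)\<^sup>2) \<in> borel_measurable (Pi\<^sub>M I (\<lambda>_. borel))"
    and g2m: "(\<lambda>x. (g x)\<^sup>2) \<in> borel_measurable (Pi\<^sub>M J (\<lambda>_. borel))"
    using f g by measurable
  have cov: "\<bar>expectation (\<lambda>\<omega>. X \<omega> * Y \<omega>) - expectation X * expectation Y\<bar>
      \<le> 2 * sqrt (phi_coeff M \<xi> r) * sqrt (expectation (\<lambda>\<omega>. (X \<omega>)\<^sup>2)) * sqrt (expectation (\<lambda>\<omega>. (Y \<omega>)\<^sup>2))"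
  proof (rule covariance_le_phi_mixing[OF subalgebra_field_algebra subalgebra_field_algebra _ X _ Y])
    show "integrable M (\<lambda>\<omega>. (X \<omega>)\<^sup>2)"
      unfolding X_def integrable_shift[OF fin(1) f2m] by (rule f2)
    show "integrable M (\<lambda>\<omega>. (Y \<omega>)\<^sup>2)"
      unfolding Y_def integrable_shift[OF fin(2) g2m] by (rule g2)
    fix A B assume "A \<in> sets ?F" "B \<in> sets ?G"
    then show "\<bar>prob (A \<inter> B) - prob A * prob B\<bar> \<le> phi_coeff M \<xi> r * prob A"
      unfolding sets_field_algebra using phi_coeff_bound[OF \<open>0 < r\<close>, of A k B]
      unfolding A_minus_def A_plus_def by blast
  qed
  have res: "(\<lambda>x. restrict x I) \<in> (\<Pi>\<^sub>M i\<in>I \<union> J. borel) \<rightarrow>\<^sub>M (\<Pi>\<^sub>M i\<in>I. borel)"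
      "(\<lambda>x. restrict x J) \<in> (\<Pi>\<^sub>M i\<in>I \<union> J. borel) \<rightarrow>\<^sub>M (\<Pi>\<^sub>M i\<in>J. borel)"
    by (auto intro: measurable_restrict_subset)
  have hm: "(\<lambda>x. f (restrict x I) * g (restrict x J)) \<in> borel_measurable (\<Pi>\<^sub>M i\<in>I \<union> J. borel)"
    by (intro borel_measurable_times measurable_compose[OF res(1) f] measurable_compose[OF res(2) g])
  have "restrict (\<lambda>i\<in>I \<union> J. u i) I = restrict u I" "restrict (\<lambda>i\<in>I \<union> J. u i) J = restrict u J"
    for u :: "int^'q \<Rightarrow> real^'p"
    by (simp_all add: restrict_restrict Int_absorb1 Un_Int_distrib2)
  then have "expectation (\<lambda>\<omega>. X \<omega> * Y \<omega>) =
      expectation (\<lambda>\<omega>. f (\<lambda>i\<in>I. \<xi> i \<omega>) * g (\<lambda>j\<in>J. \<xi> j \<omega>))"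
    using expectation_shift[OF _ hm, of v] fin unfolding X_def Y_def by simp
  with cov show ?thesis
    unfolding X_def Y_def expectation_shift[OF fin(1) f] expectation_shift[OF fin(2) g]
      expectation_shift[OF fin(1) f2m] expectation_shift[OF fin(2) g2m]
    by simp
qed

text \<open>
  The inequality is symmetric in the two variables, so either of them may lie in the past. The
  case \<open>r = 0\<close> is included so that close and distant pairs of sites can be treated by one formula; it
  rests on the convention \<open>\<phi>(0) = 1\<close> and the trivial mixing bound \<open>\<bar>P(A \<inter> B) - P(A) P(B)\<bar> \<le> P(A)\<close>.
\<close>

lemma covariance_le:
  fixes f g :: "(int^'q \<Rightarrow> real^'p) \<Rightarrow> real"
  assumes fin: "finite I" "finite J"
    and gap: "0 < r \<Longrightarrow> I \<noteq> {} \<and> J \<noteq> {} \<and>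
      ((\<forall>i\<in>I. \<forall>j\<in>J. i $ k + int r \<le> j $ k) \<or> (\<forall>i\<in>I. \<forall>j\<in>J. j $ k + int r \<le> i $ k))"
    and f: "f \<in> borel_measurable (Pi\<^sub>M I (\<lambda>_. borel))" "integrable M (\<lambda>\<omega>. (f (\<lambda>i\<in>I. \<xi> i \<omega>))\<^sup>2)"
    and g: "g \<in> borel_measurable (Pi\<^sub>M J (\<lambda>_. borel))" "integrable M (\<lambda>\<omega>. (g (\<lambda>j\<in>J. \<xi> j \<omega>))\<^sup>2)"
  shows "\<bar>expectation (\<lambda>\<omega>. f (\<lambda>i\<in>I. \<xi> i \<omega>) * g (\<lambda>j\<in>J. \<xi> j \<omega>)) -
      expectation (\<lambda>\<omega>. f (\<lambda>i\<in>I. \<xi> i \<omega>)) * expectation (\<lambda>\<omega>. g (\<lambda>j\<in>J. \<xi> j \<omega>))\<bar>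
    \<le> 2 * sqrt (phi_coeff M \<xi> r) * sqrt (expectation (\<lambda>\<omega>. (f (\<lambda>i\<in>I. \<xi> i \<omega>))\<^sup>2)) *
        sqrt (expectation (\<lambda>\<omega>. (g (\<lambda>j\<in>J. \<xi> j \<omega>))\<^sup>2))"
proof (cases "r = 0")
  case True
  have m: "(\<lambda>\<omega>. \<lambda>i\<in>L. \<xi> i \<omega>) \<in> M \<rightarrow>\<^sub>M (\<Pi>\<^sub>M i\<in>L. borel)" for L
    by (intro measurable_restrict measurable_field)
  have "\<bar>prob (A \<inter> B) - prob A * prob B\<bar> \<le> 1 * prob A" if "A \<in> events" "B \<in> events" for A B
  proof -
    have "prob (A \<inter> B) \<le> prob A" using that by (intro finite_measure_mono) auto
    moreover have "prob A * prob B \<le> prob A" by (simp add: mult_left_le)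
    moreover have "0 \<le> prob A * prob B" by simp
    ultimately show ?thesis using measure_nonneg[of M "A \<inter> B"] by linarith
  qed
  then show ?thesis
    using covariance_le_phi_mixing[of M M 1, OF _ _ _ measurable_compose[OF m f(1)] f(2) measurable_compose[OF m g(1)] g(2)]
    by (simp add: True phi_coeff_def subalgebra_def)
next
  case False
  then have "0 < r" by simp
  note ne = gap[OF this, THEN conjunct1] gap[OF this, THEN conjunct2, THEN conjunct1]
  from gap[OF \<open>0 < r\<close>, THEN conjunct2, THEN conjunct2] show ?thesis
  proof
    assume gap: "\<forall>i\<in>I. \<forall>j\<in>J. i $ k + int r \<le> j $ k"
    let ?s = "Max ((\<lambda>i. i $ k) ` I)"
    have le: "i $ k \<le> ?s" if "i \<in> I" for i using fin that by simp
    have "?s \<in> (\<lambda>i. i $ k) ` I" using fin ne by (intro Max_in) auto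
    then have "?s + int r \<le> j $ k" if "j \<in> J" for j using gap that by auto
    from covariance_le_directed[OF fin \<open>0 < r\<close> le this f(1) g(1) f(2) g(2)] show ?thesis .
  next
    assume gap: "\<forall>i\<in>I. \<forall>j\<in>J. j $ k + int r \<le> i $ k"
    let ?s = "Max ((\<lambda>j. j $ k) ` J)"
    have le: "j $ k \<le> ?s" if "j \<in> J" for j using fin that by simp
    have "?s \<in> (\<lambda>j. j $ k) ` J" using fin ne by (intro Max_in) auto
    then have "?s + int r \<le> i $ k" if "i \<in> I" for i using gap that by auto
    from covariance_le_directed[OF fin(2,1) \<open>0 < r\<close> le this g(1) f(1) g(2) f(2)] show ?thesis
      by (simp only: mult_ac)
  qed
qed

end

section \<open>Errors of the sample autocovariances\<close>

locale long_run_variance_field = stationary_field M \<xi>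
  for M :: "'a measure" and \<xi> :: "int^'q \<Rightarrow> 'a \<Rightarrow> real^'p" +
  assumes centered: "(\<integral>\<omega>. \<xi> 0 \<omega> \<partial>M) = 0"
    and moment4: "\<And>a. integrable M (\<lambda>\<omega>. (\<xi> 0 \<omega> $ a) ^ 4)"
    and rate: "summable (\<lambda>r. real (Suc r) ^ (CARD('q) - 1) * sqrt (phi_coeff M \<xi> (Suc r)))"
begin

text \<open>
  One constant that bounds the fourth moments of all components at once.
\<close>

definition moment_sum :: real where "moment_sum = (\<Sum>a\<in>UNIV. expectation (\<lambda>\<omega>. (\<xi> 0 \<omega> $ a) ^ 4))"

text \<open>
  The constant of \<open>sum_radial_shift_le\<close> for \<open>g = \<phi>\<^sup>1\<^sup>/\<^sup>2\<close>; the summand \<open>1\<close> is \<open>\<phi>(0)\<^sup>1\<^sup>/\<^sup>2\<close>.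
\<close>

definition mixing_sum :: real where
  "mixing_sum = 1 + 2 * CARD('q) * (\<Sum>r. real (Suc r) ^ (CARD('q) - 1) * sqrt (phi_coeff M \<xi> (Suc r)))"

lemma measurable_component [measurable]: "(\<lambda>\<omega>. \<xi> i \<omega> $ a) \<in> borel_measurable M"
  by (rule measurable_compose[OF measurable_field borel_measurable_nth])

lemma moment_sum_nonneg: "0 \<le> moment_sum"
  by (auto simp: moment_sum_def intro!: sum_nonneg Bochner_Integration.integral_nonneg)

lemma mixing_sum_nonneg: "0 \<le> mixing_sum"
  using suminf_nonneg[OF rate] phi_coeff_nonneg by (simp add: mixing_sum_def)

lemma sum_sqrt_phi_coeff_le:
  fixes D :: "(int^'q) set"
  assumes "finite D"
  shows "(\<Sum>d\<in>D. sqrt (phi_coeff M \<xi> (lag_norm d - N))) \<le> mixing_sum * real (2 * N + 3) ^ CARD('q)"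
  using sum_radial_shift_le[OF assms, of "\<lambda>r. sqrt (phi_coeff M \<xi> r)" N] rate phi_coeff_nonneg
  by (simp add: mixing_sum_def phi_coeff_def)

lemma integrable_fourth_power: "integrable M (\<lambda>\<omega>. (\<xi> i \<omega> $ a) ^ 4)"
  and expectation_fourth_power_le: "expectation (\<lambda>\<omega>. (\<xi> i \<omega> $ a) ^ 4) \<le> moment_sum"
proof -
  have h: "(\<lambda>x. (x 0 $ a) ^ 4) \<in> borel_measurable (\<Pi>\<^sub>M i\<in>{0 :: int^'q}. borel :: (real^'p) measure)"
    by (intro borel_measurable_times borel_measurable_power measurable_vec_coordinate) auto
  show "integrable M (\<lambda>\<omega>. (\<xi> i \<omega> $ a) ^ 4)"
    using integrable_shift[OF _ h, of i] moment4 by simp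
  have "expectation (\<lambda>\<omega>. (\<xi> i \<omega> $ a) ^ 4) = expectation (\<lambda>\<omega>. (\<xi> 0 \<omega> $ a) ^ 4)"
    using expectation_shift[OF _ h, of i] by simp
  also have "\<dots> \<le> moment_sum" unfolding moment_sum_def by (rule member_le_sum) auto
  finally show "expectation (\<lambda>\<omega>. (\<xi> i \<omega> $ a) ^ 4) \<le> moment_sum" .
qed

lemma integrable_component_square: "integrable M (\<lambda>\<omega>. (\<xi> i \<omega> $ a)\<^sup>2)"
  and expectation_component_square_le: "expectation (\<lambda>\<omega>. (\<xi> i \<omega> $ a)\<^sup>2) \<le> 1 + moment_sum"
proof -
  have le: "x\<^sup>2 \<le> 1 + x ^ 4" for x :: real
  proof -
    have "2 * x\<^sup>2 * 1 \<le> (x\<^sup>2)\<^sup>2 + 1\<^sup>2" by (rule sum_squares_bound)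
    moreover have "(x\<^sup>2)\<^sup>2 = x ^ 4" by simp
    moreover have "0 \<le> x\<^sup>2" by simp
    ultimately show ?thesis unfolding power_one mult_1_right by linarith
  qed
  have int: "integrable M (\<lambda>\<omega>. 1 + (\<xi> i \<omega> $ a) ^ 4)"
    using integrable_fourth_power by simp
  show *: "integrable M (\<lambda>\<omega>. (\<xi> i \<omega> $ a)\<^sup>2)"
    by (rule Bochner_Integration.integrable_bound[OF int]) (measurable, auto simp: le)
  have "expectation (\<lambda>\<omega>. (\<xi> i \<omega> $ a)\<^sup>2) \<le> expectation (\<lambda>\<omega>. 1 + (\<xi> i \<omega> $ a) ^ 4)"
    by (rule integral_mono[OF * int le])
  also have "\<dots> \<le> 1 + moment_sum"
    using expectation_fourth_power_le integrable_fourth_power by (simp add: prob_space)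
  finally show "expectation (\<lambda>\<omega>. (\<xi> i \<omega> $ a)\<^sup>2) \<le> 1 + moment_sum" .
qed

lemma expectation_component: "expectation (\<lambda>\<omega>. \<xi> i \<omega> $ a) = 0"
proof -
  have int: "integrable M (\<lambda>\<omega>. \<xi> 0 \<omega> $ a)" for a
    by (rule square_integrable_imp_integrable[OF measurable_component integrable_component_square])
  have "integrable M (\<xi> 0)" by (intro integrable_vec_componentwise int) measurable
  from integral_bounded_linear[OF bounded_linear_vec_nth this, of a]
  have 0: "expectation (\<lambda>\<omega>. \<xi> 0 \<omega> $ a) = 0" by (simp add: centered)
  have h: "(\<lambda>x. x 0 $ a) \<in> borel_measurable (\<Pi>\<^sub>M i\<in>{0 :: int^'q}. borel :: (real^'p) measure)"
    by (intro borel_measurable_times borel_measurable_power measurable_vec_coordinate) auto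
  show ?thesis using expectation_shift[OF _ h, of i] 0 by simp
qed

definition lag_product :: "'p \<Rightarrow> 'p \<Rightarrow> int^'q \<Rightarrow> int^'q \<Rightarrow> 'a \<Rightarrow> real" where
  "lag_product a b j i \<omega> = \<xi> i \<omega> $ a * \<xi> (i + j) \<omega> $ b"

lemma measurable_lag_product [measurable]: "lag_product a b j i \<in> borel_measurable M"
  unfolding lag_product_def[abs_def] by measurable

lemma integrable_lag_product: "integrable M (lag_product a b j i)"
  unfolding lag_product_def[abs_def]
  by (intro integrable_mult_of_squares integrable_component_square) measurable

lemma integrable_lag_product_square: "integrable M (\<lambda>\<omega>. (lag_product a b j i \<omega>)\<^sup>2)"
  and expectation_lag_product_square_le: "expectation (\<lambda>\<omega>. (lag_product a b j i \<omega>)\<^sup>2) \<le> moment_sum"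
proof -
  have le: "(x * y)\<^sup>2 \<le> (x ^ 4 + y ^ 4) / 2" for x y :: real
    using sum_squares_bound[of "x\<^sup>2" "y\<^sup>2"] by (simp add: power_mult_distrib)
  have int: "integrable M (\<lambda>\<omega>. ((\<xi> i \<omega> $ a) ^ 4 + (\<xi> (i + j) \<omega> $ b) ^ 4) / 2)"
    using integrable_fourth_power by simp
  show *: "integrable M (\<lambda>\<omega>. (lag_product a b j i \<omega>)\<^sup>2)"
  proof (rule Bochner_Integration.integrable_bound[OF int])
    show "AE \<omega> in M. norm ((lag_product a b j i \<omega>)\<^sup>2) \<le>
        norm (((\<xi> i \<omega> $ a) ^ 4 + (\<xi> (i + j) \<omega> $ b) ^ 4) / 2)"
      unfolding lag_product_def real_norm_def abs_power2
      by (intro AE_I2 order_trans[OF le abs_ge_self])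
  qed measurable
  have "expectation (\<lambda>\<omega>. (lag_product a b j i \<omega>)\<^sup>2) \<le>
      expectation (\<lambda>\<omega>. ((\<xi> i \<omega> $ a) ^ 4 + (\<xi> (i + j) \<omega> $ b) ^ 4) / 2)"
    by (rule integral_mono[OF * int]) (simp only: lag_product_def le)
  also have "\<dots> \<le> moment_sum"
    using expectation_fourth_power_le[of i a] expectation_fourth_power_le[of "i + j" b]
      integrable_fourth_power by simp
  finally show "expectation (\<lambda>\<omega>. (lag_product a b j i \<omega>)\<^sup>2) \<le> moment_sum" .
qed

lemma autocov_component: "autocov M \<xi> j $ a $ b = expectation (lag_product a b j 0)"
proof -
  have "integrable M (\<lambda>\<omega>. outer_prod (\<xi> 0 \<omega>) (\<xi> j \<omega>) $ a $ b)" for a b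
    using integrable_lag_product[of a b j 0] by (simp add: outer_prod_def lag_product_def[abs_def])
  from integral_matrix_component[OF this] show ?thesis
    by (simp add: autocov_def outer_prod_def lag_product_def[abs_def])
qed

lemma expectation_lag_product: "expectation (lag_product a b j i) = autocov M \<xi> j $ a $ b"
proof -
  have h: "(\<lambda>x. x 0 $ a * x j $ b) \<in> borel_measurable (\<Pi>\<^sub>M i\<in>{0, j}. borel :: (real^'p) measure)"
    by (intro borel_measurable_times borel_measurable_power measurable_vec_coordinate) auto
  show ?thesis
    using expectation_shift[OF _ h, of i]
    by (simp add: autocov_component lag_product_def[abs_def] add.commute)
qed

text \<open>
  The lag \<open>j\<close> attains its norm in some coordinate, in which the sites \<open>0\<close> and \<open>j\<close> are separated by
  \<open>\<bar>j\<bar>\<close>. Because the field is centered, the autocovariance is a covariance.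
\<close>

lemma autocov_le: "\<bar>autocov M \<xi> j $ a $ b\<bar> \<le> 2 * (1 + moment_sum) * sqrt (phi_coeff M \<xi> (lag_norm j))"
proof -
  obtain k where k: "\<bar>j $ k\<bar> = int (lag_norm j)" by (rule lag_norm_attained)
  have m: "(\<lambda>x. x i $ c) \<in> borel_measurable (\<Pi>\<^sub>M i\<in>{i :: int^'q}. borel :: (real^'p) measure)" for i c
    by (intro borel_measurable_times borel_measurable_power measurable_vec_coordinate) auto
  have "\<bar>autocov M \<xi> j $ a $ b\<bar> \<le> 2 * sqrt (phi_coeff M \<xi> (lag_norm j)) *
      sqrt (expectation (\<lambda>\<omega>. (\<xi> 0 \<omega> $ a)\<^sup>2)) * sqrt (expectation (\<lambda>\<omega>. (\<xi> j \<omega> $ b)\<^sup>2))"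
    using covariance_le[of "{0}" "{j}" "lag_norm j" k, OF _ _ _ m[of 0 a] _ m[of j b]] k
      integrable_component_square expectation_component
    by (auto simp: autocov_component lag_product_def[abs_def] abs_if split: if_splits)
  also have "\<dots> \<le> 2 * sqrt (phi_coeff M \<xi> (lag_norm j)) * sqrt (1 + moment_sum) * sqrt (1 + moment_sum)"
    using expectation_component_square_le phi_coeff_nonneg moment_sum_nonneg by (intro mult_mono) auto
  also have "\<dots> = 2 * sqrt (phi_coeff M \<xi> (lag_norm j)) * (sqrt (1 + moment_sum) * sqrt (1 + moment_sum))" by (simp only: mult.assoc)
  also have "sqrt (1 + moment_sum) * sqrt (1 + moment_sum) = 1 + moment_sum" using moment_sum_nonneg by simp
  finally show ?thesis by (simp only: mult_ac)
qed

lemma abs_summable_autocov: "(\<lambda>j. norm (autocov M \<xi> j)) summable_on UNIV"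
proof (rule nonneg_bdd_above_summable_on)
  define C where "C = real CARD('p) * (real CARD('p) * (2 * (1 + moment_sum)))"
  have "0 \<le> C" using moment_sum_nonneg by (simp add: C_def)
  have le: "norm (autocov M \<xi> j) \<le> C * sqrt (phi_coeff M \<xi> (lag_norm j))" for j
  proof -
    have "norm (autocov M \<xi> j) \<le> (\<Sum>a\<in>UNIV. norm (autocov M \<xi> j $ a))"
      by (simp add: norm_vec_def L2_set_le_sum)
    also have "\<dots> \<le> (\<Sum>a\<in>(UNIV :: 'p set). \<Sum>b\<in>(UNIV :: 'p set). 2 * (1 + moment_sum) * sqrt (phi_coeff M \<xi> (lag_norm j)))"
      by (intro sum_mono order_trans[OF norm_le_l1_cart] autocov_le)
    finally show ?thesis by (simp add: C_def mult.assoc)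
  qed
  have "(\<Sum>j\<in>D. norm (autocov M \<xi> j)) \<le> C * (mixing_sum * real (2 * 0 + 3) ^ CARD('q))" if "finite D" for D
  proof -
    have "(\<Sum>j\<in>D. norm (autocov M \<xi> j)) \<le> (\<Sum>j\<in>D. C * sqrt (phi_coeff M \<xi> (lag_norm j - 0)))"
      using le by (intro sum_mono) simp
    also have "\<dots> = C * (\<Sum>j\<in>D. sqrt (phi_coeff M \<xi> (lag_norm j - 0)))" by (simp only: sum_distrib_left)
    also have "\<dots> \<le> C * (mixing_sum * real (2 * 0 + 3) ^ CARD('q))"
      using \<open>0 \<le> C\<close> that by (intro mult_left_mono sum_sqrt_phi_coeff_le)
    finally show ?thesis .
  qed
  then show "bdd_above (sum (\<lambda>j. norm (autocov M \<xi> j)) ` {F. F \<subseteq> UNIV \<and> finite F})"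
    by (auto simp: bdd_above_def)
qed simp

text \<open>
  In a coordinate where \<open>i' - i\<close> attains its norm, the pairs \<open>{i, i + j}\<close> and \<open>{i', i' + j}\<close> are
  separated by at least \<open>\<bar>i' - i\<bar> - \<bar>j\<bar>\<close>. If this is not positive, truncated subtraction yields
  \<open>\<phi>(0) = 1\<close>, so the same formula covers close and distant pairs.
\<close>

lemma covariance_lag_product_le:
  assumes "lag_norm j \<le> N"
  shows "\<bar>expectation (\<lambda>\<omega>. lag_product a b j i \<omega> * lag_product a b j i' \<omega>) -
      (autocov M \<xi> j $ a $ b)\<^sup>2\<bar> \<le> 2 * moment_sum * sqrt (phi_coeff M \<xi> (lag_norm (i' - i) - N))"
proof -
  obtain k where k: "\<bar>(i' - i) $ k\<bar> = int (lag_norm (i' - i))" by (rule lag_norm_attained)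
  have jk: "\<bar>j $ k\<bar> \<le> int N" using assms lag_norm_le_iff by blast
  have m: "(\<lambda>x. x i $ a * x (i + j) $ b) \<in> borel_measurable (\<Pi>\<^sub>M i\<in>{i, i + j}. borel :: (real^'p) measure)" for i
    by (intro borel_measurable_times borel_measurable_power measurable_vec_coordinate) auto
  have gap: "{i, i + j} \<noteq> {} \<and> {i', i' + j} \<noteq> {} \<and> ((\<forall>u\<in>{i, i + j}. \<forall>v\<in>{i', i' + j}. u $ k + int (lag_norm (i' - i) - N) \<le> v $ k) \<or>
      (\<forall>u\<in>{i, i + j}. \<forall>v\<in>{i', i' + j}. v $ k + int (lag_norm (i' - i) - N) \<le> u $ k))"
    if "0 < lag_norm (i' - i) - N"
  proof -
    have "int (lag_norm (i' - i) - N) = int (lag_norm (i' - i)) - int N" using that by simp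
    then show ?thesis using k jk by (cases "0 \<le> i' $ k - i $ k") auto
  qed
  have sq: "integrable M (\<lambda>\<omega>. (\<xi> i \<omega> $ a * \<xi> (i + j) \<omega> $ b)\<^sup>2)" for i
    using integrable_lag_product_square[of a b j i] by (simp add: lag_product_def)
  have ex: "expectation (\<lambda>\<omega>. \<xi> i \<omega> $ a * \<xi> (i + j) \<omega> $ b) = autocov M \<xi> j $ a $ b" for i
    using expectation_lag_product[of a b j i] by (simp add: lag_product_def[abs_def])
  have "\<bar>expectation (\<lambda>\<omega>. lag_product a b j i \<omega> * lag_product a b j i' \<omega>) - (autocov M \<xi> j $ a $ b)\<^sup>2\<bar>
      \<le> 2 * sqrt (phi_coeff M \<xi> (lag_norm (i' - i) - N)) * sqrt (expectation (\<lambda>\<omega>. (lag_product a b j i \<omega>)\<^sup>2)) *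
        sqrt (expectation (\<lambda>\<omega>. (lag_product a b j i' \<omega>)\<^sup>2))"
    using covariance_le[of "{i, i + j}" "{i', i' + j}" "lag_norm (i' - i) - N" k, OF _ _ gap m[of i] _ m[of i']]
    by (simp add: sq ex lag_product_def power2_eq_square[of "autocov M \<xi> j $ a $ b"])
  also have "\<dots> \<le> 2 * sqrt (phi_coeff M \<xi> (lag_norm (i' - i) - N)) * sqrt moment_sum * sqrt moment_sum"
    using expectation_lag_product_square_le phi_coeff_nonneg moment_sum_nonneg by (intro mult_mono) auto
  also have "\<dots> = 2 * sqrt (phi_coeff M \<xi> (lag_norm (i' - i) - N)) * (sqrt moment_sum * sqrt moment_sum)" by (simp only: mult.assoc)
  also have "sqrt moment_sum * sqrt moment_sum = moment_sum" using moment_sum_nonneg by simp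
  finally show ?thesis by (simp only: mult_ac)
qed

lemma integrable_lag_product_mult: "integrable M (\<lambda>\<omega>. lag_product a b j i \<omega> * lag_product a b j i' \<omega>)"
  by (intro integrable_mult_of_squares integrable_lag_product_square) measurable

text \<open>
  Expanding the square gives the covariances of all pairs of lag products. For each \<open>i\<close> the
  covariances with all other sites sum to at most a constant times \<open>(2 N + 3)\<^sup>q\<close>, so the variance is
  linear in the number of summands.
\<close>

lemma
  assumes "finite G" and "lag_norm j \<le> N"
  shows integrable_lag_sum_square:
      "integrable M (\<lambda>\<omega>. (\<Sum>i\<in>G. lag_product a b j i \<omega> - autocov M \<xi> j $ a $ b)\<^sup>2)"
    and expectation_lag_sum_square_le:
      "expectation (\<lambda>\<omega>. (\<Sum>i\<in>G. lag_product a b j i \<omega> - autocov M \<xi> j $ a $ b)\<^sup>2) \<le>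
        real (card G) * (2 * moment_sum * (mixing_sum * real (2 * N + 3) ^ CARD('q)))"
proof -
  define c where "c = autocov M \<xi> j $ a $ b"
  define U where "U = lag_product a b j"
  have expand: "(\<Sum>i\<in>G. U i \<omega> - c)\<^sup>2 = (\<Sum>i\<in>G. \<Sum>i'\<in>G. (U i \<omega> * U i' \<omega> - c * U i \<omega> - c * U i' \<omega> + c\<^sup>2))" for \<omega>
    unfolding power2_eq_square sum_product by (intro sum.cong refl) (simp add: algebra_simps)
  have int: "integrable M (\<lambda>\<omega>. U i \<omega> * U i' \<omega> - c * U i \<omega> - c * U i' \<omega> + c\<^sup>2)" for i i'
    unfolding U_def using integrable_lag_product_mult integrable_lag_product by simp
  show "integrable M (\<lambda>\<omega>. (\<Sum>i\<in>G. lag_product a b j i \<omega> - autocov M \<xi> j $ a $ b)\<^sup>2)"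
    unfolding c_def[symmetric] U_def[symmetric] expand
    by (intro Bochner_Integration.integrable_sum int)
  have cov: "expectation (\<lambda>\<omega>. U i \<omega> * U i' \<omega> - c * U i \<omega> - c * U i' \<omega> + c\<^sup>2) = expectation (\<lambda>\<omega>. U i \<omega> * U i' \<omega>) - c\<^sup>2" for i i'
    unfolding U_def using integrable_lag_product_mult[of a b j i i'] integrable_lag_product[of a b j]
      expectation_lag_product[of a b j]
    by (simp add: prob_space c_def[symmetric] power2_eq_square)
  have "expectation (\<lambda>\<omega>. (\<Sum>i\<in>G. U i \<omega> - c)\<^sup>2) = (\<Sum>i\<in>G. \<Sum>i'\<in>G. expectation (\<lambda>\<omega>. U i \<omega> * U i' \<omega>) - c\<^sup>2)"
    unfolding expand
    by (simp add: Bochner_Integration.integral_sum int Bochner_Integration.integrable_sum cov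
        del: Bochner_Integration.integral_add Bochner_Integration.integral_diff)
  also have "\<dots> \<le> (\<Sum>i\<in>G. 2 * moment_sum * (mixing_sum * real (2 * N + 3) ^ CARD('q)))"
  proof (rule sum_mono)
    fix i
    have "(\<Sum>i'\<in>G. expectation (\<lambda>\<omega>. U i \<omega> * U i' \<omega>) - c\<^sup>2) \<le>
        (\<Sum>i'\<in>G. 2 * moment_sum * sqrt (phi_coeff M \<xi> (lag_norm (i' - i) - N)))"
      unfolding U_def c_def
      by (intro sum_mono order_trans[OF abs_ge_self covariance_lag_product_le[OF assms(2)]])
    also have "\<dots> = 2 * moment_sum * (\<Sum>d\<in>(\<lambda>i'. i' - i) ` G. sqrt (phi_coeff M \<xi> (lag_norm d - N)))"
      by (subst sum.reindex) (auto simp: inj_on_def sum_distrib_left)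
    also have "\<dots> \<le> 2 * moment_sum * (mixing_sum * real (2 * N + 3) ^ CARD('q))"
      using moment_sum_nonneg assms(1) by (intro mult_left_mono sum_sqrt_phi_coeff_le) auto
    finally show "(\<Sum>i'\<in>G. expectation (\<lambda>\<omega>. U i \<omega> * U i' \<omega>) - c\<^sup>2) \<le> 2 * moment_sum * (mixing_sum * real (2 * N + 3) ^ CARD('q))" .
  qed
  finally show "expectation (\<lambda>\<omega>. (\<Sum>i\<in>G. lag_product a b j i \<omega> - autocov M \<xi> j $ a $ b)\<^sup>2) \<le>
        real (card G) * (2 * moment_sum * (mixing_sum * real (2 * N + 3) ^ CARD('q)))"
    unfolding c_def U_def by simp
qed

lemma sample_autocov_component:
  "sample_autocov \<xi> n j \<omega> $ a $ b =
    (\<Sum>i\<in>Gamma_shift n j. lag_product a b j i \<omega>) / real (card (Gamma_shift n j))"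
  by (simp add: sample_autocov_def outer_prod_def lag_product_def)

lemma integrable_sample_autocov: "integrable M (\<lambda>\<omega>. sample_autocov \<xi> n j \<omega> $ a $ b)"
  unfolding sample_autocov_component using integrable_lag_product by simp

text \<open>
  The standard deviation of the mean of the lag products bounds its mean distance from the
  autocovariance, and at least \<open>(L - N)\<^sup>q\<close> products are averaged, where \<open>L\<close> is the smallest side of the
  observation box.
\<close>

lemma expectation_sample_autocov_error_le:
  assumes "lag_norm j \<le> N" and "N < min_comp n"
  shows "expectation (\<lambda>\<omega>. \<bar>sample_autocov \<xi> n j \<omega> $ a $ b - autocov M \<xi> j $ a $ b\<bar>) \<le>
    sqrt (2 * moment_sum * mixing_sum * (real (2 * N + 3) / real (min_comp n - N)) ^ CARD('q))"
proof -
  define G where "G = Gamma_shift n j"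
  define c where "c = autocov M \<xi> j $ a $ b"
  define B where "B = 2 * moment_sum * (mixing_sum * real (2 * N + 3) ^ CARD('q))"
  define Z where "Z \<omega> = (\<Sum>i\<in>G. lag_product a b j i \<omega> - c)" for \<omega>
  have [measurable]: "Z \<in> borel_measurable M" unfolding Z_def[abs_def] by measurable
  have "finite G" by (simp add: G_def finite_Gamma_shift)
  have card: "(min_comp n - N) ^ CARD('q) \<le> card G"
    using card_Gamma_shift_ge[OF assms(1)] by (simp add: G_def)
  have "0 < (min_comp n - N) ^ CARD('q)" using assms(2) by simp
  with card have pos: "0 < card G" by linarith
  have "0 \<le> B" using moment_sum_nonneg mixing_sum_nonneg by (simp add: B_def)
  have "sample_autocov \<xi> n j \<omega> $ a $ b - c = Z \<omega> / real (card G)" for \<omega>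
    using pos by (simp add: sample_autocov_component Z_def G_def sum_subtractf field_simps)
  then have "expectation (\<lambda>\<omega>. \<bar>sample_autocov \<xi> n j \<omega> $ a $ b - c\<bar>) = expectation (\<lambda>\<omega>. \<bar>Z \<omega>\<bar>) / real (card G)"
    by (simp add: abs_divide)
  also have "\<dots> \<le> sqrt (expectation (\<lambda>\<omega>. (Z \<omega>)\<^sup>2)) / real (card G)"
    using integrable_lag_sum_square[OF \<open>finite G\<close> assms(1)]
    unfolding Z_def c_def by (intro divide_right_mono expectation_abs_le_sqrt) auto
  also have "\<dots> \<le> sqrt (real (card G) * B) / real (card G)"
    using expectation_lag_sum_square_le[OF \<open>finite G\<close> assms(1)]
    unfolding Z_def c_def B_def by (intro divide_right_mono real_sqrt_le_mono) auto
  also have "\<dots> = sqrt (B / real (card G))"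
  proof -
    have "sqrt (x * B) / x = sqrt (B / x)" if "0 < x" for x
    proof -
      have "sqrt (x * B) / x = sqrt (x * B) / sqrt (x\<^sup>2)" using that by simp
      also have "\<dots> = sqrt (x * B / x\<^sup>2)" by (simp only: real_sqrt_divide)
      also have "x * B / x\<^sup>2 = B / x" using that by (simp add: power2_eq_square)
      finally show ?thesis .
    qed
    then show ?thesis using pos by simp
  qed
  also have "\<dots> \<le> sqrt (B / real ((min_comp n - N) ^ CARD('q)))"
    using card pos \<open>0 \<le> B\<close> \<open>0 < (min_comp n - N) ^ CARD('q)\<close>
    by (intro real_sqrt_le_mono divide_left_mono mult_pos_pos)
      (simp_all only: of_nat_le_iff of_nat_0_less_iff)
  finally show ?thesis by (simp add: B_def c_def power_divide mult.assoc)
qed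

text \<open>
  The triangle inequality suffices: the factor \<open>(2 N + 3)\<^sup>q\<close> for the number of lags, moved under the
  square root of the error of a single lag, raises the power of \<open>2 N + 3\<close> from \<open>1\<close> to \<open>3\<close>.
\<close>

lemma expectation_weighted_error_le:
  fixes m n :: "nat^'q" and u :: "int^'q \<Rightarrow> real"
  assumes u: "\<And>j. \<bar>u j\<bar> \<le> C" and mn: "max_comp m < min_comp n"
  shows "expectation (\<lambda>\<omega>. \<bar>\<Sum>j\<in>lag_window m. u j * (sample_autocov \<xi> n j \<omega> $ a $ b - autocov M \<xi> j $ a $ b)\<bar>) \<le>
    C * sqrt (2 * moment_sum * mixing_sum) * sqrt ((real (2 * max_comp m + 3) ^ 3 / real (min_comp n - max_comp m)) ^ CARD('q))"
proof -
  let ?N = "max_comp m" and ?L = "real (min_comp n - max_comp m)"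
  let ?E = "\<lambda>j \<omega>. sample_autocov \<xi> n j \<omega> $ a $ b - autocov M \<xi> j $ a $ b"
  let ?e = "sqrt (2 * moment_sum * mixing_sum * (real (2 * ?N + 3) / ?L) ^ CARD('q))"
  have "0 \<le> C" using u[of undefined] by simp
  have int: "integrable M (\<lambda>\<omega>. \<bar>?E j \<omega>\<bar>)" for j using integrable_sample_autocov by simp
  have "0 \<le> ?e" using moment_sum_nonneg mixing_sum_nonneg by simp
  have "expectation (\<lambda>\<omega>. \<bar>\<Sum>j\<in>lag_window m. u j * ?E j \<omega>\<bar>) \<le> expectation (\<lambda>\<omega>. \<Sum>j\<in>lag_window m. C * \<bar>?E j \<omega>\<bar>)"
  proof (rule integral_mono)
    fix \<omega>
    show "\<bar>\<Sum>j\<in>lag_window m. u j * ?E j \<omega>\<bar> \<le> (\<Sum>j\<in>lag_window m. C * \<bar>?E j \<omega>\<bar>)"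
      using u by (intro order_trans[OF sum_abs] sum_mono) (simp add: abs_mult mult_right_mono)
  qed (use int integrable_sample_autocov in simp_all)
  also have "\<dots> = (\<Sum>j\<in>lag_window m. C * expectation (\<lambda>\<omega>. \<bar>?E j \<omega>\<bar>))"
    using int by (subst Bochner_Integration.integral_sum) auto
  also have "\<dots> \<le> (\<Sum>j\<in>lag_window m. C * ?e)"
    using lag_window_subset_ball[of m] mn \<open>0 \<le> C\<close>
    by (intro sum_mono mult_left_mono expectation_sample_autocov_error_le) auto
  also have "\<dots> = real (card (lag_window m)) * (C * ?e)" by simp
  also have "\<dots> \<le> real (2 * ?N + 3) ^ CARD('q) * (C * ?e)"
  proof (intro mult_right_mono)
    have "card (lag_window m) \<le> (2 * ?N + 1) ^ CARD('q)" by (rule card_lag_window_le)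
    also have "\<dots> \<le> (2 * ?N + 3) ^ CARD('q)" by (intro power_mono) auto
    finally show "real (card (lag_window m)) \<le> real (2 * ?N + 3) ^ CARD('q)"
      by (metis of_nat_le_iff of_nat_power)
  qed (use \<open>0 \<le> C\<close> \<open>0 \<le> ?e\<close> in simp)
  also have "\<dots> = C * sqrt (2 * moment_sum * mixing_sum) * (sqrt ((real (2 * ?N + 3) ^ CARD('q))\<^sup>2) * sqrt ((real (2 * ?N + 3) / ?L) ^ CARD('q)))"
    by (simp add: real_sqrt_mult)
  also have "sqrt ((real (2 * ?N + 3) ^ CARD('q))\<^sup>2) * sqrt ((real (2 * ?N + 3) / ?L) ^ CARD('q)) =
      sqrt ((real (2 * ?N + 3) ^ 3 / ?L) ^ CARD('q))"
  proof -
    have "(x ^ q)\<^sup>2 * (x / y) ^ q = (x ^ 3 / y) ^ q" for x y :: real and q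
    proof -
      have "(x ^ q)\<^sup>2 = (x\<^sup>2) ^ q" by (simp only: power_mult[symmetric] mult.commute)
      then have "(x ^ q)\<^sup>2 * (x / y) ^ q = (x\<^sup>2 * (x / y)) ^ q" by (simp only: power_mult_distrib)
      also have "x\<^sup>2 * (x / y) = x ^ 3 / y" by (simp add: power2_eq_square power3_eq_cube)
      finally show ?thesis .
    qed
    then show ?thesis by (simp only: real_sqrt_mult[symmetric])
  qed
  finally show ?thesis .
qed

end

section \<open>Consistency of the long-run variance estimator\<close>

text \<open>
  Once \<open>N \<ge> 1\<close> and \<open>N\<^sup>3 / L < 1 / 2\<close>, it follows that \<open>N \<le> N\<^sup>3 < L / 2\<close>, hence \<open>L - N \<ge> L / 2\<close> and
  \<open>2 N + 3 \<le> 5 N\<close>. Here \<open>N\<close> and \<open>L\<close> are the largest component of \<open>m\<close> and the smallest of \<open>n\<close>.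
\<close>

lemma tendsto_window_ratio:
  fixes m :: "nat^'q \<Rightarrow> nat^'q"
  assumes m: "filterlim m multi_at_top multi_at_top"
    and r: "((\<lambda>n. real (max_comp (m n)) ^ 3 / real (min_comp n)) \<longlongrightarrow> 0) multi_at_top"
  shows "eventually (\<lambda>n. max_comp (m n) < min_comp n) multi_at_top"
    and "((\<lambda>n. real (2 * max_comp (m n) + 3) ^ 3 / real (min_comp n - max_comp (m n))) \<longlongrightarrow> 0) multi_at_top"
proof -
  have "filterlim (\<lambda>n. min_comp (m n)) at_top multi_at_top"
    by (rule filterlim_compose[OF filterlim_min_comp m])
  then have "eventually (\<lambda>n. 1 \<le> min_comp (m n)) multi_at_top"
    by (auto simp: filterlim_at_top)
  moreover have "eventually (\<lambda>n :: nat^'q. 1 \<le> min_comp n) multi_at_top"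
    using filterlim_min_comp by (auto simp: filterlim_at_top)
  moreover have "eventually (\<lambda>n. real (max_comp (m n)) ^ 3 / real (min_comp n) < 1 / 2) multi_at_top"
    by (rule order_tendstoD(2)[OF r]) simp
  ultimately have *: "eventually (\<lambda>n. 1 \<le> max_comp (m n) \<and> 2 * max_comp (m n) < min_comp n) multi_at_top"
  proof eventually_elim
    case (elim n)
    have 1: "1 \<le> max_comp (m n)" using elim(1) min_comp_le_max_comp[of "m n"] by linarith
    have "real (max_comp (m n)) \<le> real (max_comp (m n)) ^ 3"
      using 1 by (intro self_le_power) auto
    moreover have "real (max_comp (m n)) ^ 3 < real (min_comp n) / 2"
      using elim(2,3) by (simp add: divide_less_eq)
    ultimately have "2 * real (max_comp (m n)) < real (min_comp n)" by linarith
    then have "real (2 * max_comp (m n)) < real (min_comp n)" by simp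
    then show ?case using 1 by (simp only: of_nat_less_iff)
  qed
  then show "eventually (\<lambda>n. max_comp (m n) < min_comp n) multi_at_top"
    by eventually_elim simp
  have lim: "((\<lambda>n. 250 * (real (max_comp (m n)) ^ 3 / real (min_comp n))) \<longlongrightarrow> 0) multi_at_top"
    using tendsto_mult_right_zero[OF r] .
  show "((\<lambda>n. real (2 * max_comp (m n) + 3) ^ 3 / real (min_comp n - max_comp (m n))) \<longlongrightarrow> 0) multi_at_top"
  proof (rule tendsto_sandwich[OF _ _ tendsto_const lim])
    from * show "eventually (\<lambda>n. real (2 * max_comp (m n) + 3) ^ 3 / real (min_comp n - max_comp (m n))
        \<le> 250 * (real (max_comp (m n)) ^ 3 / real (min_comp n))) multi_at_top"
    proof eventually_elim
      case (elim n)
      have "real (2 * max_comp (m n) + 3) ^ 3 / real (min_comp n - max_comp (m n)) \<le>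
          (5 * real (max_comp (m n))) ^ 3 / (real (min_comp n) / 2)"
        using elim by (intro frac_le power_mono) (auto simp: of_nat_diff)
      also have "\<dots> = 250 * (real (max_comp (m n)) ^ 3 / real (min_comp n))"
        by (simp add: power_mult_distrib)
      finally show ?case .
    qed
  qed (auto intro!: always_eventually)
qed

theorem theorem2p1:
  fixes M :: "'a measure"
    and \<xi> :: "int^'q \<Rightarrow> 'a \<Rightarrow> real^'p"
    and w :: "nat^'q \<Rightarrow> int^'q \<Rightarrow> real"
    and m :: "nat^'q \<Rightarrow> nat^'q"
    and C\<^sub>w :: real
  assumes "prob_space M"
    and "random_field M \<xi>"
    and "strictly_stationary M \<xi>"
    and "phi_mixing M \<xi>"
    and "(\<integral>\<omega>. \<xi> 0 \<omega> \<partial>M) = 0"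
    and "\<And>j. integrable M (\<lambda>\<omega>. (\<xi> 0 \<omega> $ j) ^ 4)"
    and "summable (\<lambda>r. real (Suc r) ^ (CARD('q) - 1) * sqrt (phi_coeff M \<xi> (Suc r)))"
    and W1: "\<And>j. ((\<lambda>k. w k j) \<longlongrightarrow> 1) multi_at_top"
    and W2: "\<And>k j. \<bar>w k j\<bar> \<le> C\<^sub>w"
    and "filterlim m multi_at_top multi_at_top"
    and "((\<lambda>n. real (max_comp (m n)) ^ 3 / real (min_comp n)) \<longlongrightarrow> 0) multi_at_top"
  shows "tendsto_in_prob M
           (\<lambda>n \<omega>. mat_supnorm (variance_estimator w \<xi> (m n) n \<omega> - asymp_variance M \<xi>))
           0 multi_at_top"
proof -
  interpret prob_space M by fact
  interpret long_run_variance_field M \<xi>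
    by unfold_locales (fact assms)+
  \<comment> \<open>the random part and the bias of the estimator\<close>
  define V where "V n \<omega> = (\<Sum>j\<in>lag_window (m n). w (m n) j *\<^sub>R (sample_autocov \<xi> n j \<omega> - autocov M \<xi> j))" for n \<omega>
  define \<beta> where "\<beta> n = (\<Sum>j\<in>lag_window (m n). w (m n) j *\<^sub>R autocov M \<xi> j) - asymp_variance M \<xi>" for n
  define Y where "Y n \<omega> = (\<Sum>a\<in>UNIV. \<Sum>b\<in>UNIV. \<bar>V n \<omega> $ a $ b\<bar>) + norm (\<beta> n)" for n \<omega>
  define e where "e n = C\<^sub>w * sqrt (2 * moment_sum * mixing_sum) *
    sqrt ((real (2 * max_comp (m n) + 3) ^ 3 / real (min_comp n - max_comp (m n))) ^ CARD('q))" for n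
  have split: "variance_estimator w \<xi> (m n) n \<omega> - asymp_variance M \<xi> = V n \<omega> + \<beta> n" for n \<omega>
    by (simp add: variance_estimator_def V_def \<beta>_def scaleR_diff_right sum_subtractf)
  have V: "V n \<omega> $ a $ b = (\<Sum>j\<in>lag_window (m n). w (m n) j * (sample_autocov \<xi> n j \<omega> $ a $ b - autocov M \<xi> j $ a $ b))"
    for n \<omega> a b by (simp add: V_def)
  have intV: "integrable M (\<lambda>\<omega>. \<bar>V n \<omega> $ a $ b\<bar>)" for n a b
    unfolding V using integrable_sample_autocov by simp
  note lims = tendsto_window_ratio[OF assms(10,11)]
  have "((\<lambda>k. \<Sum>j\<in>lag_window k. w k j *\<^sub>R autocov M \<xi> j) \<longlongrightarrow> asymp_variance M \<xi>) multi_at_top"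
    unfolding asymp_variance_def
    by (rule tendsto_weighted_sum_lag_window[OF abs_summable_autocov W1 W2])
  then have "(\<beta> \<longlongrightarrow> asymp_variance M \<xi> - asymp_variance M \<xi>) multi_at_top"
    unfolding \<beta>_def[abs_def] by (intro tendsto_diff tendsto_const filterlim_compose[OF _ assms(10)])
  then have bias: "((\<lambda>n. norm (\<beta> n)) \<longlongrightarrow> 0) multi_at_top"
    by (simp add: tendsto_norm_zero)
  have "(e \<longlongrightarrow> C\<^sub>w * sqrt (2 * moment_sum * mixing_sum) * sqrt (0 ^ CARD('q))) multi_at_top"
    unfolding e_def[abs_def] by (intro tendsto_intros lims)
  moreover have "(0 :: real) ^ CARD('q) = 0" by (rule zero_power) simp
  ultimately have e: "(e \<longlongrightarrow> 0) multi_at_top" by simp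
  show ?thesis
  proof (rule tendsto_in_prob_of_dominating_mean)
    show "((\<lambda>n. real CARD('p) * (real CARD('p) * e n) + norm (\<beta> n)) \<longlongrightarrow> 0) multi_at_top"
      using e bias by (intro tendsto_add_zero tendsto_mult_right_zero)
    from lims(1) show "eventually (\<lambda>n. integrable M (Y n) \<and>
        (\<forall>\<omega>\<in>space M. \<bar>mat_supnorm (variance_estimator w \<xi> (m n) n \<omega> - asymp_variance M \<xi>)\<bar> \<le> Y n \<omega>) \<and>
        expectation (Y n) \<le> real CARD('p) * (real CARD('p) * e n) + norm (\<beta> n)) multi_at_top"
    proof eventually_elim
      case (elim n)
      have "integrable M (Y n)" unfolding Y_def[abs_def] using intV by simp
      moreover have "\<bar>mat_supnorm (variance_estimator w \<xi> (m n) n \<omega> - asymp_variance M \<xi>)\<bar> \<le> Y n \<omega>" for \<omega>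
        unfolding split Y_def using mat_supnorm_add_le[of "V n \<omega>" "\<beta> n"] mat_supnorm_nonneg[of "V n \<omega> + \<beta> n"] by simp
      moreover have "expectation (Y n) \<le> real CARD('p) * (real CARD('p) * e n) + norm (\<beta> n)"
      proof -
        have "expectation (Y n) = (\<Sum>a\<in>UNIV. \<Sum>b\<in>UNIV. expectation (\<lambda>\<omega>. \<bar>V n \<omega> $ a $ b\<bar>)) + norm (\<beta> n)"
          unfolding Y_def[abs_def] using intV by (simp add: prob_space Bochner_Integration.integral_sum)
        also have "\<dots> \<le> (\<Sum>a\<in>(UNIV :: 'p set). \<Sum>b\<in>(UNIV :: 'p set). e n) + norm (\<beta> n)"
          unfolding V e_def
          by (intro add_right_mono sum_mono expectation_weighted_error_le W2 elim)
        finally show ?thesis by simp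
      qed
      ultimately show ?case by blast
    qed
  qed
qed

end
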